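(* Let $A\in\mathbb{R}^{n\times n}$ be invertible, let $W\in\mathbb{R}^{n\times n}$ be symmetric positive definite, and let $S$ be a random matrix with $n$ rows and $q$ columns, with distribution $\mathcal{D}$, which has full column rank with probability $1$. Let $$Z=A^TS(S^TAWA^TS)^{-1}S^TA,\qquad \rho=1-\lambda_{\min}\left(W^{1/2}\,\mathbf{E}[Z]\,W^{1/2}\right).$$ Then the iterates of Algorithm 1 (nonsymmetric row variant, defined in the context) satisfy, for every $k\ge 0$, $$\mathbf{E}\left[X_{k+1}-A^{-1}\right]=(I-W\,\mathbf{E}[Z])\,\mathbf{E}\left[X_k-A^{-1}\right].$$ Let $X_0\in\mathbb{R}^{n\times n}$. If $X_k$ is calculated in either one of these two ways: 1. applying $k$ iterations of Algorithm 1 started from $X_0$, 2. applying $k$ iterations of Algorithm 3 (symmetric variant, defined in the context) started from $X_0$, assuming $A$ and $X_0$ are symmetric, then $$\left\|\mathbf{E}\left[X_k-A^{-1}\right]\right\|_{W^{-1}}\le\rho^k\left\|X_0-A^{-1}\right\|_{W^{-1}}.$$ Moreover, $$0\le 1-\frac{\mathbf{E}[q]}{n}\le\rho\le 1.$$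
   Context: For $Y\in\mathbb{R}^{n\times n}$, $\|Y\|_{W^{-1}}=\|W^{-1/2}YW^{-1/2}\|_2$, where $\|\cdot\|_2$ is the operator norm induced by the Euclidean vector norm. $\lambda_{\min}$ denotes the smallest eigenvalue and $I$ is the $n\times n$ identity. The number of columns $q$ of $S$ may itself be random. Algorithm 1: starting from a fixed $X_0\in\mathbb{R}^{n\times n}$, for $k=0,1,2,\dots$ sample an independent copy $S\sim\mathcal{D}$ (independent of all previous samples) and set $$X_{k+1}=X_k+WA^TS(S^TAWA^TS)^{-1}S^T(I-AX_k).$$ Algorithm 3 (for symmetric $A$ and symmetric $X_0$): for $k=0,1,2,\dots$ sample an independent copy $S\sim\mathcal{D}$, compute $\Lambda=S(S^TAWAS)^{-1}S^T$, $\Theta=\Lambda AW$, $M_k=X_kA-I$, and set $$X_{k+1}=X_k-M_k\Theta-(M_k\Theta)^T+\Theta^T(AX_kA-A)\Theta.$$ *)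

theory Defs
  imports "HOL-Probability.Probability" "Jordan_Normal_Form.DL_Rank"
    "Jordan_Normal_Form.Gauss_Jordan_Elimination" "Jordan_Normal_Form.Char_Poly"
begin

text \<open>The number of columns of the sketch is random, so matrices are those of
  \<open>Jordan_Normal_Form.Matrix\<close>, which carry their dimensions as data.\<close>

text \<open>The inverse is only meaningful for invertible matrices; the zero matrix is a
  placeholder on the null event where the sketch does not have full column rank.\<close>

definition mat_inv :: "real mat \<Rightarrow> real mat" where
  "mat_inv B = (case mat_inverse B of Some C \<Rightarrow> C | None \<Rightarrow> 0\<^sub>m (dim_row B) (dim_col B))"

definition sym_mat :: "real mat \<Rightarrow> bool" where
  "sym_mat B \<longleftrightarrow> transpose_mat B = B"

definition spd_mat :: "nat \<Rightarrow> real mat \<Rightarrow> bool" where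
  "spd_mat n B \<longleftrightarrow> B \<in> carrier_mat n n \<and> sym_mat B \<and>
     (\<forall>v \<in> carrier_vec n. v \<noteq> 0\<^sub>v n \<longrightarrow> 0 < scalar_prod v (B *\<^sub>v v))"

text \<open>The principal square root of a symmetric positive definite matrix.\<close>

definition mat_sqrt :: "real mat \<Rightarrow> real mat" where
  "mat_sqrt B = (THE R. spd_mat (dim_row B) R \<and> R * R = B)"

definition euclid_norm :: "real Matrix.vec \<Rightarrow> real" where
  "euclid_norm v = sqrt (scalar_prod v v)"

definition op_norm :: "real mat \<Rightarrow> real" where
  "op_norm Y = (SUP v \<in> {v \<in> carrier_vec (dim_col Y). v \<noteq> 0\<^sub>v (dim_col Y)}.
     euclid_norm (Y *\<^sub>v v) / euclid_norm v)"

text \<open>\<open>weighted_norm W Y\<close> is the norm of \<open>Y\<close> with subscript \<open>W\<^sup>-\<^sup>1\<close>; the factor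
  \<open>mat_inv (mat_sqrt W)\<close> is \<open>W\<close> to the power \<open>-1/2\<close>.\<close>

definition weighted_norm :: "real mat \<Rightarrow> real mat \<Rightarrow> real" where
  "weighted_norm W Y = op_norm (mat_inv (mat_sqrt W) * Y * mat_inv (mat_sqrt W))"

text \<open>Smallest real eigenvalue; it is only applied to symmetric matrices, all of whose
  eigenvalues are real.\<close>

definition lambda_min :: "real mat \<Rightarrow> real" where
  "lambda_min B = Min {l. eigenvalue B l}"

text \<open>Matrices with \<open>n\<close> rows and any number of columns, as the disjoint union over \<open>q\<close> of
  the Borel spaces of \<open>n \<times> q\<close> matrices. The generators \<open>carrier_mat n q\<close> are needed
  only when there are no entries.\<close>

definition sketch_space :: "nat \<Rightarrow> real mat measure" where
  "sketch_space n = sigma {S. dim_row S = n}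
     ({carrier_mat n q | q. True} \<union>
      {{S \<in> carrier_mat n q. S $$ (i, j) \<in> B} | q i j B. i < n \<and> j < q \<and> B \<in> sets borel})"

definition full_column_rank :: "real mat \<Rightarrow> bool" where
  "full_column_rank S \<longleftrightarrow> vec_space.rank (dim_row S) S = dim_col S"

text \<open>Entrywise expectation of a random \<open>n \<times> n\<close> matrix.\<close>

definition expected_mat :: "nat \<Rightarrow> 'w measure \<Rightarrow> ('w \<Rightarrow> real mat) \<Rightarrow> real mat" where
  "expected_mat n M Y = Matrix.mat n n (\<lambda>(i, j). \<integral>\<omega>. Y \<omega> $$ (i, j) \<partial>M)"

definition sketch_Z :: "real mat \<Rightarrow> real mat \<Rightarrow> real mat \<Rightarrow> real mat" where
  "sketch_Z A W S = transpose_mat A * S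
     * mat_inv (transpose_mat S * A * W * transpose_mat A * S) * transpose_mat S * A"

definition expected_Z :: "nat \<Rightarrow> real mat \<Rightarrow> real mat \<Rightarrow> real mat measure \<Rightarrow> real mat" where
  "expected_Z n A W D = expected_mat n D (sketch_Z A W)"

definition rate :: "nat \<Rightarrow> real mat \<Rightarrow> real mat \<Rightarrow> real mat measure \<Rightarrow> real" where
  "rate n A W D = 1 - lambda_min (mat_sqrt W * expected_Z n A W D * mat_sqrt W)"

text \<open>The iterates along a given sequence \<open>S\<close> of sketches, \<open>S k\<close> being the one drawn in
  step \<open>k\<close>.\<close>

primrec alg1 :: "real mat \<Rightarrow> real mat \<Rightarrow> real mat \<Rightarrow> (nat \<Rightarrow> real mat) \<Rightarrow> nat \<Rightarrow> real mat" where
  "alg1 A W X0 S 0 = X0"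
| "alg1 A W X0 S (Suc k) = alg1 A W X0 S k
     + W * transpose_mat A * S k
       * mat_inv (transpose_mat (S k) * A * W * transpose_mat A * S k)
       * transpose_mat (S k) * (1\<^sub>m (dim_row A) - A * alg1 A W X0 S k)"

primrec alg3 :: "real mat \<Rightarrow> real mat \<Rightarrow> real mat \<Rightarrow> (nat \<Rightarrow> real mat) \<Rightarrow> nat \<Rightarrow> real mat" where
  "alg3 A W X0 S 0 = X0"
| "alg3 A W X0 S (Suc k) =
    (let X = alg3 A W X0 S k;
         \<Lambda> = S k * mat_inv (transpose_mat (S k) * A * W * A * S k) * transpose_mat (S k);
         \<Theta> = \<Lambda> * A * W;
         M = X * A - 1\<^sub>m (dim_row A)
     in X - M * \<Theta> - transpose_mat (M * \<Theta>) + transpose_mat \<Theta> * (A * X * A - A) * \<Theta>)"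

end

theory Submission
  imports Defs "Jordan_Normal_Form.Schur_Decomposition" "Jordan_Normal_Form.Spectral_Radius"
begin

text \<open>Let \<open>R\<close> be the square root of \<open>W\<close> and \<open>P = R Z R\<close>. Multiplying the error by the inverse of \<open>R\<close> on both
  sides turns one step into multiplication by \<open>I - P\<close>, on the left in Algorithm 1 and on both sides
  in Algorithm 3. Each \<open>P\<close> is an orthogonal projection of trace at most \<open>q\<close>, even where the sketch is
  rank deficient and \<open>mat_inv\<close> returns zero, so all iterates are bounded, and by independence the
  new sketch can be averaged against the expected error. The contraction comes from the bilinear
  form: for an orthogonal projection \<open>Q\<close>, \<open>u \<bullet> Q B Q v \<le> \<parallel>B\<parallel> (u \<bullet> Q u + v \<bullet> Q v) / 2\<close>, and the
  expectation of \<open>u \<bullet> (I - P) u\<close> is at most \<open>\<rho> (u \<bullet> u)\<close>. The bounds on \<open>\<rho>\<close> compare the trace of the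
  expected projection with \<open>n\<close> times its smallest eigenvalue.\<close>

text \<open>For Algorithm 1 submultiplicativity is enough, because the expected error is simply
  multiplied by \<open>I - E[P]\<close>. In Algorithm 3 the same random projection Q = I - P stands
  on both sides of the error B, so the expectation of Q B Q is not a product, and bounding its norm
  inside the expectation gives only the factor 1, the norm of every nonzero orthogonal projection.
  The bilinear bound escapes this: since |Q u|^2 = u . Q u, its right-hand side is linear in Q,
  averaging it leaves E[Q] alone, and the largest eigenvalue of E[Q] is \<rho>. The case B = I then
  bounds the norm of \<open>I - E[P]\<close> and serves Algorithm 1. The one-step bounds can be
  multiplied over k steps only if \<rho> is nonnegative; this is drawn from q \<le> n, which is what
  full column rank gives. Averaging needs no conditional expectation: an entry of a product of three
  matrices is a finite sum of products of two independent real random variables, one a function of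
  the new sketch, the other of the earlier ones.\<close>

no_notation vec_nth (infixl "$" 90)
no_notation fps_nth (infixl "$" 75)

section \<open>Inverses and the spectral theorem\<close>

text \<open>The library rules leave the inner dimensions as variables occurring only in premises.
  With all of them fixed to \<open>n\<close>, the simplifier can discharge the carrier
  conditions.\<close>

lemmas square_mult_simps = assoc_mult_mat[of _ n n _ n _ n] mult_carrier_mat[of _ n n _ n]
  left_mult_one_mat[of _ n n] right_mult_one_mat[of _ n n] for n

lemma mat_inv_carrier [simp]:
  assumes "B \<in> carrier_mat n n"
  shows "mat_inv B \<in> carrier_mat n n"
proof (cases "mat_inverse B")
  case None
  then show ?thesis using assms by (auto simp: mat_inv_def)
next
  case (Some C)
  then show ?thesis using mat_inverse(2)[OF assms Some] by (auto simp: mat_inv_def)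
qed

lemma mat_inv_singular:
  assumes B: "B \<in> carrier_mat n n" and "det B = 0"
  shows "mat_inv B = 0\<^sub>m n n"
proof (cases "mat_inverse B")
  case None
  then show ?thesis using assms by (auto simp: mat_inv_def)
next
  case (Some C)
  note C = mat_inverse(2)[OF B Some]
  then have "det B * det C = 1" using B det_mult[of B n C] by simp
  with assms show ?thesis by simp
qed

lemma mat_inv_regular:
  assumes B: "B \<in> carrier_mat n n" and "det B \<noteq> 0"
  shows "B * mat_inv B = 1\<^sub>m n" "mat_inv B * B = 1\<^sub>m n"
proof -
  have "mat_inverse B \<noteq> None"
    using det_non_zero_imp_unit[OF B assms(2), of undefined] mat_inverse(1)[OF B, of undefined] by blast
  then obtain C where "mat_inverse B = Some C" by auto
  then show "B * mat_inv B = 1\<^sub>m n" "mat_inv B * B = 1\<^sub>m n"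
    using mat_inverse(2)[OF B] by (auto simp: mat_inv_def)
qed

lemma inverse_mat_unique:
  fixes B :: "real mat"
  assumes "B \<in> carrier_mat n n" "C \<in> carrier_mat n n" "E \<in> carrier_mat n n"
    "B * C = 1\<^sub>m n" "B * E = 1\<^sub>m n"
  shows "C = E"
proof -
  have "C * B = 1\<^sub>m n" using assms mat_mult_left_right_inverse by blast
  then have "C = (C * B) * C" using assms by simp
  also have "\<dots> = C * (B * E)" using assms by (simp add: square_mult_simps[where n = n])
  also have "\<dots> = (C * B) * E" using assms by (simp add: square_mult_simps[where n = n])
  finally show ?thesis using \<open>C * B = 1\<^sub>m n\<close> assms by simp
qed

text \<open>\<open>mat_inverse\<close> runs Gauss-Jordan elimination, whose result is hard to follow
  as a function of the entries. The adjugate formula makes each entry a quotient of determinants,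
  and this is the form in which measurability of the inverse is proved.\<close>

lemma mat_inv_eq_adj:
  assumes B: "B \<in> carrier_mat n n"
  shows "mat_inv B = (if det B = 0 then 0\<^sub>m n n else (1 / det B) \<cdot>\<^sub>m adj_mat B)"
proof (cases "det B = 0")
  case False
  have c: "(1 / det B) \<cdot>\<^sub>m adj_mat B \<in> carrier_mat n n" using adj_mat(1)[OF B] by simp
  have "B * ((1 / det B) \<cdot>\<^sub>m adj_mat B) = (1 / det B) \<cdot>\<^sub>m (B * adj_mat B)"
    using B adj_mat(1)[OF B] by (simp add: mult_smult_distrib)
  also have "\<dots> = 1\<^sub>m n"
    using adj_mat(2)[OF B] False by (intro eq_matI) auto
  finally show ?thesis
    using False inverse_mat_unique[OF B mat_inv_carrier[OF B] c mat_inv_regular(1)[OF B False]]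
    by simp
qed (simp add: mat_inv_singular[OF B])

lemma mat_inv_sym:
  assumes B: "B \<in> carrier_mat n n" and sym: "transpose_mat B = B"
  shows "transpose_mat (mat_inv B) = mat_inv B"
proof (cases "det B = 0")
  case False
  have "B * transpose_mat (mat_inv B) = transpose_mat (mat_inv B * B)"
    using B sym by (simp add: transpose_mult[of _ n n _ n])
  also have "\<dots> = 1\<^sub>m n" using mat_inv_regular[OF B False] by simp
  finally show ?thesis
    using inverse_mat_unique[OF B _ mat_inv_carrier[OF B] _ mat_inv_regular(1)[OF B False]] B
    by simp
qed (simp add: mat_inv_singular[OF B])

section \<open>Real eigenvalues and orthogonal diagonalization of symmetric matrices\<close>

lemma scalar_prod_self_nonneg: "0 \<le> scalar_prod v (v :: real Matrix.vec)"
  by (auto simp: scalar_prod_def intro!: sum_nonneg)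

lemma scalar_prod_self_eq_0:
  assumes "v \<in> carrier_vec n"
  shows "scalar_prod v (v :: real Matrix.vec) = 0 \<longleftrightarrow> v = 0\<^sub>v n"
proof
  assume "scalar_prod v v = 0"
  then have "\<And>i. i < n \<Longrightarrow> v $ i = 0"
    using assms by (auto simp: scalar_prod_def sum_nonneg_eq_0_iff)
  then show "v = 0\<^sub>v n" using assms by (intro eq_vecI) auto
qed (use assms in auto)

lemma symmetric_scalar_prod:
  fixes B :: "real mat"
  assumes "B \<in> carrier_mat n n" "transpose_mat B = B" "x \<in> carrier_vec n" "y \<in> carrier_vec n"
  shows "scalar_prod x (B *\<^sub>v y) = scalar_prod (B *\<^sub>v x) y"
  using transpose_vec_mult_scalar[of B n n y x] assms by simp

text \<open>Over the complex numbers an eigenvector x + i y with eigenvalue l exists. Evaluating x .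
  B y = B x . y through the real and imaginary parts of the eigenvalue equation gives Im l (|x|^2 +
  |y|^2) = 0, so l is real, and whichever of x and y is nonzero is a real eigenvector.\<close>

lemma symmetric_real_eigenvalue_exists:
  fixes B :: "real mat"
  assumes B: "B \<in> carrier_mat n n" and sym: "transpose_mat B = B" and n: "0 < n"
  obtains e where "eigenvalue B e"
proof -
  let ?C = "map_mat complex_of_real B"
  have "?C \<in> carrier_mat n n" using B by simp
  from spectrum_non_empty[OF this n] obtain l where "eigenvalue ?C l"
    by (auto simp: spectrum_def)
  then obtain v where v: "v \<in> carrier_vec n" "v \<noteq> 0\<^sub>v n" "?C *\<^sub>v v = l \<cdot>\<^sub>v v"
    using B by (auto simp: eigenvalue_def eigenvector_def)
  define x where "x = map_vec Re v"
  define y where "y = map_vec Im v"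
  have xy: "x \<in> carrier_vec n" "y \<in> carrier_vec n" using v by (auto simp: x_def y_def)
  have entry: "(\<Sum>j<n. complex_of_real (B $$ (i, j)) * v $ j) = l * v $ i" if "i < n" for i
    using arg_cong[OF v(3), of "\<lambda>w. w $ i"] that B v(1)
    by (simp add: scalar_prod_def lessThan_atLeast0)
  have Bx: "B *\<^sub>v x = Re l \<cdot>\<^sub>v x - Im l \<cdot>\<^sub>v y"
  proof (rule eq_vecI)
    fix i assume "i < dim_vec (Re l \<cdot>\<^sub>v x - Im l \<cdot>\<^sub>v y)"
    then have i: "i < n" using xy by simp
    show "(B *\<^sub>v x) $ i = (Re l \<cdot>\<^sub>v x - Im l \<cdot>\<^sub>v y) $ i"
      using arg_cong[OF entry[OF i], of Re] i B v(1)
      by (simp add: x_def y_def scalar_prod_def lessThan_atLeast0)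
  qed (use B xy in auto)
  have By: "B *\<^sub>v y = Im l \<cdot>\<^sub>v x + Re l \<cdot>\<^sub>v y"
  proof (rule eq_vecI)
    fix i assume "i < dim_vec (Im l \<cdot>\<^sub>v x + Re l \<cdot>\<^sub>v y)"
    then have i: "i < n" using xy by simp
    show "(B *\<^sub>v y) $ i = (Im l \<cdot>\<^sub>v x + Re l \<cdot>\<^sub>v y) $ i"
      using arg_cong[OF entry[OF i], of Im] i B v(1)
      by (simp add: x_def y_def scalar_prod_def lessThan_atLeast0)
  qed (use B xy in auto)
  have nz: "x \<noteq> 0\<^sub>v n \<or> y \<noteq> 0\<^sub>v n"
  proof (rule ccontr)
    assume "\<not> ?thesis"
    then have "\<And>i. i < n \<Longrightarrow> Re (v $ i) = 0 \<and> Im (v $ i) = 0"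
      using v(1) unfolding x_def y_def
      by (metis carrier_vecD index_map_vec(1) index_zero_vec(1))
    then have "v = 0\<^sub>v n" using v(1) by (intro eq_vecI) (auto simp: complex_eq_iff)
    with v(2) show False by simp
  qed
  have "scalar_prod x (B *\<^sub>v y) = Im l * scalar_prod x x + Re l * scalar_prod x y"
    unfolding By using xy by (simp add: scalar_prod_add_distrib[of _ n])
  moreover have "scalar_prod (B *\<^sub>v x) y = Re l * scalar_prod x y - Im l * scalar_prod y y"
    unfolding Bx using xy by (simp add: minus_scalar_prod_distrib[of _ n])
  ultimately have "Im l * (scalar_prod x x + scalar_prod y y) = 0"
    using symmetric_scalar_prod[OF B sym xy] by (simp add: algebra_simps)
  moreover have "scalar_prod x x + scalar_prod y y \<noteq> 0"
    using nz scalar_prod_self_eq_0 xy scalar_prod_self_nonneg[of x] scalar_prod_self_nonneg[of y]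
    by (smt (verit))
  ultimately have "Im l = 0" by simp
  then have "B *\<^sub>v x = Re l \<cdot>\<^sub>v x" "B *\<^sub>v y = Re l \<cdot>\<^sub>v y"
    using Bx By xy by auto
  then have "eigenvalue B (Re l)"
    using nz xy B by (auto simp: eigenvalue_def eigenvector_def)
  then show thesis by (rule that)
qed

text \<open>The columns of \<open>Q\<close> come from completing \<open>u\<close> to a basis,
  applying Gram-Schmidt, which keeps the first vector, and normalizing. The factor \<open>c\<close>
  is the reciprocal of the length of \<open>u\<close>; its value is left open since any multiple of
  an eigenvector serves for deflation.\<close>

lemma orthonormal_completion:
  fixes u :: "real Matrix.vec"
  assumes u: "u \<in> carrier_vec n" "u \<noteq> 0\<^sub>v n"
  obtains Q c where "Q \<in> carrier_mat n n" "transpose_mat Q * Q = 1\<^sub>m n" "col Q 0 = c \<cdot>\<^sub>v u"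
proof -
  interpret cof_vec_space n "TYPE(real)" .
  note bc = basis_completion[OF u]
  define ws where "ws = gram_schmidt n (basis_completion u)"
  note gs = gram_schmidt_result[OF bc(2) bc(4) bc(5) ws_def]
  have n: "n \<noteq> 0" using u by (intro notI) (auto intro!: eq_vecI)
  have len: "length ws = n" using gs(4) bc(6) by simp
  obtain rest where "basis_completion u = u # rest"
    using bc(6,7) n by (cases "basis_completion u") auto
  then have "hd ws = u" unfolding ws_def using gram_schmidt_hd[OF u(1)] by simp
  then have ws0: "ws ! 0 = u" using len n by (metis hd_conv_nth length_0_conv)
  define N where "N i = sqrt (scalar_prod (ws ! i) (ws ! i))" for i
  have wsc: "ws ! i \<in> carrier_vec n" if "i < n" for i using gs(3) len that by auto
  \<comment> \<open>The library states orthogonality with the conjugate inner product, which over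
    the reals is the plain one.\<close>
  have conj: "conjugate v = v" for v :: "real Matrix.vec" by (intro eq_vecI) auto
  have orth: "scalar_prod (ws ! i) (ws ! j) = 0 \<longleftrightarrow> i \<noteq> j" if "i < n" "j < n" for i j
    using corthogonalD[OF gs(2), of i j] that len by (simp add: conj)
  have Npos: "N i * N i = scalar_prod (ws ! i) (ws ! i)" "N i \<noteq> 0" if "i < n" for i
    using orth[OF that that] scalar_prod_self_nonneg[of "ws ! i"] by (auto simp: N_def)
  define Q where "Q = Matrix.mat n n (\<lambda>(i, j). (ws ! j) $ i / N j)"
  have Qc: "Q \<in> carrier_mat n n" by (simp add: Q_def)
  have colQ: "col Q j = (1 / N j) \<cdot>\<^sub>v (ws ! j)" if "j < n" for j
    using wsc[OF that] that by (intro eq_vecI) (auto simp: Q_def)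
  have "transpose_mat Q * Q = 1\<^sub>m n"
  proof (rule eq_matI)
    fix i j assume "i < dim_row (1\<^sub>m n :: real mat)" "j < dim_col (1\<^sub>m n :: real mat)"
    then have ij: "i < n" "j < n" by auto
    have "(transpose_mat Q * Q) $$ (i, j) = scalar_prod (col Q i) (col Q j)"
      using ij Qc by simp
    also have "\<dots> = scalar_prod (ws ! i) (ws ! j) / (N i * N j)"
      using wsc[OF ij(1)] wsc[OF ij(2)] ij by (simp add: colQ)
    also have "\<dots> = (1\<^sub>m n :: real mat) $$ (i, j)"
      using ij orth[OF ij] Npos[OF ij(1)] by auto
    finally show "(transpose_mat Q * Q) $$ (i, j) = (1\<^sub>m n :: real mat) $$ (i, j)" .
  qed (use Qc in auto)
  moreover have "col Q 0 = (1 / N 0) \<cdot>\<^sub>v u" using colQ[of 0] n ws0 by simp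
  ultimately show thesis using that[OF Qc] by blast
qed

text \<open>Deflation by induction on the dimension: in an orthonormal basis that starts with an
  eigenvector, the first column vanishes below the corner, by symmetry so does the first row beyond
  it, and the remaining block is symmetric of size \<open>n\<close>.\<close>

lemma real_spectral_theorem:
  fixes B :: "real mat"
  assumes "B \<in> carrier_mat n n" "transpose_mat B = B"
  obtains Q d where "Q \<in> carrier_mat n n" "transpose_mat Q * Q = 1\<^sub>m n"
    "B = Q * mat_diag n d * transpose_mat Q"
proof -
  have "\<exists>Q d. Q \<in> carrier_mat n n \<and> transpose_mat Q * Q = 1\<^sub>m n \<and>
    B = Q * mat_diag n d * transpose_mat Q"
    using assms
  proof (induction n arbitrary: B)
    case 0
    then show ?case by (intro exI[of _ "1\<^sub>m 0"] exI[of _ "\<lambda>_. 0"]) (auto intro!: eq_matI)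
  next
    case (Suc n)
    note B = Suc.prems
    let ?n = "Suc n"
    obtain e where "eigenvalue B e" using symmetric_real_eigenvalue_exists[OF B] by blast
    then obtain u where u: "u \<in> carrier_vec ?n" "u \<noteq> 0\<^sub>v ?n" "B *\<^sub>v u = e \<cdot>\<^sub>v u"
      using B by (auto simp: eigenvalue_def eigenvector_def)
    obtain P c where P: "P \<in> carrier_mat ?n ?n" "transpose_mat P * P = 1\<^sub>m ?n" "col P 0 = c \<cdot>\<^sub>v u"
      using orthonormal_completion[OF u(1,2)] by blast
    have PPt: "P * transpose_mat P = 1\<^sub>m ?n"
      using P mat_mult_left_right_inverse by (metis transpose_carrier_mat)
    note assoc = square_mult_simps[where n = "?n"]
    define C where "C = transpose_mat P * (B * P)"
    have C: "C \<in> carrier_mat ?n ?n" "transpose_mat C = C"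
      using P B by (auto simp: C_def transpose_mult[of _ ?n ?n _ ?n] assoc)
    have BC: "B = P * C * transpose_mat P"
    proof -
      have "P * C * transpose_mat P = (P * transpose_mat P) * B * (P * transpose_mat P)"
        unfolding C_def using P(1) B by (simp add: assoc)
      then show ?thesis using PPt B by simp
    qed
    \<comment> \<open>With p the first column of \<open>P\<close>, the first column of
      \<open>C\<close> is e times the transpose of \<open>P\<close> applied to p, and this is e
      times the first unit vector by orthonormality.\<close>
    have colC: "C $$ (i, 0) = (if i = 0 then e else 0)" if i: "i < ?n" for i
    proof -
      have "B *\<^sub>v col P 0 = e \<cdot>\<^sub>v col P 0"
        using u B P by (auto simp: mult_mat_vec smult_smult_assoc ac_simps)
      moreover have "col (B * P) 0 = B *\<^sub>v col P 0" using B P by (intro col_mult2) auto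
      ultimately have "C $$ (i, 0) = e * scalar_prod (col P i) (col P 0)"
        unfolding C_def using i P B u(1) by simp
      also have "scalar_prod (col P i) (col P 0) = (transpose_mat P * P) $$ (i, 0)"
        using i P(1) by simp
      finally show ?thesis using P(2) i by simp
    qed
    have rowC: "C $$ (0, i) = (if i = 0 then e else 0)" if i: "i < ?n" for i
      using colC[OF i] C i by (metis carrier_matD index_transpose_mat(1) zero_less_Suc)
    define C' where "C' = Matrix.mat n n (\<lambda>(i, j). C $$ (Suc i, Suc j))"
    have "transpose_mat C' = C'"
    proof (rule eq_matI)
      fix i j assume "i < dim_row C'" "j < dim_col C'"
      then show "transpose_mat C' $$ (i, j) = C' $$ (i, j)"
        using C(1) index_transpose_mat(1)[of "Suc i" C "Suc j", unfolded C(2)] by (simp add: C'_def)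
    qed (auto simp: C'_def)
    moreover have C'c: "C' \<in> carrier_mat n n" by (simp add: C'_def)
    ultimately obtain Q' d' where Q': "Q' \<in> carrier_mat n n" "transpose_mat Q' * Q' = 1\<^sub>m n"
      "C' = Q' * mat_diag n d' * transpose_mat Q'"
      using Suc.IH by blast
    \<comment> \<open>\<open>R\<close> fixes the first coordinate and diagonalizes the lower block;
      accordingly \<open>d\<close> puts \<open>e\<close> in front of the eigenvalues of that
      block.\<close>
    define R where "R = four_block_mat (1\<^sub>m 1) (0\<^sub>m 1 n) (0\<^sub>m n 1) Q'"
    define d where "d i = (case i of 0 \<Rightarrow> e | Suc j \<Rightarrow> d' j)" for i
    have R: "R \<in> carrier_mat ?n ?n" using Q' four_block_carrier_mat[of "1\<^sub>m 1" 1 1 Q' n n]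
      by (simp add: R_def)
    have Rt: "transpose_mat R = four_block_mat (1\<^sub>m 1) (0\<^sub>m 1 n) (0\<^sub>m n 1) (transpose_mat Q')"
      unfolding R_def using Q' by (subst transpose_four_block_mat) auto
    have RR: "transpose_mat R * R = 1\<^sub>m ?n"
      unfolding Rt unfolding R_def using Q'
      by (subst mult_four_block_mat[of _ 1 1 _ n _ n _ _ 1 _ n]) (auto)
    have diag: "mat_diag ?n d = four_block_mat (e \<cdot>\<^sub>m 1\<^sub>m 1) (0\<^sub>m 1 n) (0\<^sub>m n 1) (mat_diag n d')"
      by (intro eq_matI) (auto simp: mat_diag_def d_def split: nat.split)
    have Cblock: "C = four_block_mat (e \<cdot>\<^sub>m 1\<^sub>m 1) (0\<^sub>m 1 n) (0\<^sub>m n 1) C'"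
      using C colC rowC by (intro eq_matI) (auto simp: C'_def)
    have "R * mat_diag ?n d = four_block_mat (e \<cdot>\<^sub>m 1\<^sub>m 1) (0\<^sub>m 1 n) (0\<^sub>m n 1) (Q' * mat_diag n d')"
      unfolding diag unfolding R_def using Q'
      by (subst mult_four_block_mat[of _ 1 1 _ n _ n _ _ 1 _ n]) (auto simp: left_mult_zero_mat[OF mat_diag_dim])
    moreover have "Q' * mat_diag n d' \<in> carrier_mat n n"
      "Q' * mat_diag n d' * transpose_mat Q' \<in> carrier_mat n n"
      using Q'(1) by auto
    ultimately have CR: "C = R * mat_diag ?n d * transpose_mat R"
      unfolding Rt Cblock Q'(3) using Q'(1)
      by (simp, subst mult_four_block_mat[of _ 1 1 _ n _ n _ _ 1 _ n])
         (auto simp: carrier_matD[OF mat_diag_dim])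
    have PR: "P * R \<in> carrier_mat ?n ?n" using P R by simp
    have "transpose_mat (P * R) * (P * R) = transpose_mat R * (transpose_mat P * P) * R"
      using P(1) R by (simp add: assoc transpose_mult[of _ ?n ?n _ ?n])
    then have "transpose_mat (P * R) * (P * R) = 1\<^sub>m ?n" using P(2) R RR by simp
    moreover have "B = (P * R) * mat_diag ?n d * transpose_mat (P * R)"
      unfolding BC CR using P(1) R by (simp add: assoc transpose_mult[of _ ?n ?n _ ?n])
    ultimately show ?case using PR by blast
  qed
  then show thesis using that by blast
qed

section \<open>Symmetric matrices and the operator norm\<close>

lemma mult_mat_zero_vec:
  "Y \<in> carrier_mat m n \<Longrightarrow> Y *\<^sub>v 0\<^sub>v n = (0\<^sub>v m :: 'a :: semiring_0 Matrix.vec)"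
  by (intro eq_vecI) (auto simp: scalar_prod_def)

lemma zero_mat_mult_vec:
  "v \<in> carrier_vec n \<Longrightarrow> 0\<^sub>m m n *\<^sub>v v = (0\<^sub>v m :: 'a :: semiring_0 Matrix.vec)"
  by (intro eq_vecI) (auto simp: scalar_prod_def)

lemma mat_diag_mult_vec:
  assumes "v \<in> carrier_vec n"
  shows "mat_diag n d *\<^sub>v v = Matrix.vec n (\<lambda>i. d i * (v $ i :: real))"
proof (rule eq_vecI)
  fix i assume "i < dim_vec (Matrix.vec n (\<lambda>i. d i * v $ i))"
  then have i: "i < n" by simp
  have "(mat_diag n d *\<^sub>v v) $ i = (\<Sum>j = 0..<n. (if i = j then d j else 0) * v $ j)"
    using i assms by (simp add: mat_diag_def scalar_prod_def)
  also have "\<dots> = (\<Sum>j = 0..<n. if j = i then d j * v $ j else 0)"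
    by (rule sum.cong) auto
  also have "\<dots> = d i * v $ i" using i by simp
  finally show "(mat_diag n d *\<^sub>v v) $ i = Matrix.vec n (\<lambda>i. d i * v $ i) $ i" using i by simp
qed (auto simp: mat_diag_def)

lemma orthogonal_conjugate_quadratic_form:
  fixes Q :: "real mat"
  assumes Q: "Q \<in> carrier_mat n n" and v: "v \<in> carrier_vec n"
  shows "scalar_prod v ((Q * mat_diag n d * transpose_mat Q) *\<^sub>v v)
    = (\<Sum>i<n. d i * ((transpose_mat Q *\<^sub>v v) $ i)\<^sup>2)"
proof -
  define w where "w = transpose_mat Q *\<^sub>v v"
  have w: "w \<in> carrier_vec n" using Q v by (simp add: w_def)
  have "(Q * mat_diag n d * transpose_mat Q) *\<^sub>v v = Q *\<^sub>v (mat_diag n d *\<^sub>v w)"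
    using Q v by (simp add: w_def assoc_mult_mat_vec[of _ n n _ n])
  then have "scalar_prod v ((Q * mat_diag n d * transpose_mat Q) *\<^sub>v v)
      = scalar_prod w (mat_diag n d *\<^sub>v w)"
    using transpose_vec_mult_scalar[OF Q _ v, of "mat_diag n d *\<^sub>v w"] w
    by (simp add: w_def mat_diag_mult_vec)
  also have "\<dots> = (\<Sum>i<n. d i * (w $ i)\<^sup>2)"
    using w by (auto simp: mat_diag_mult_vec scalar_prod_def lessThan_atLeast0 power2_eq_square
        intro!: sum.cong)
  finally show ?thesis by (simp add: w_def)
qed

text \<open>This is the quadratic form formula with all diagonal entries 1, where the conjugated
  matrix is the identity.\<close>

lemma orthogonal_transpose_norm:
  fixes Q :: "real mat"
  assumes Q: "Q \<in> carrier_mat n n" "transpose_mat Q * Q = 1\<^sub>m n" and v: "v \<in> carrier_vec n"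
  shows "(\<Sum>i<n. ((transpose_mat Q *\<^sub>v v) $ i)\<^sup>2) = scalar_prod v v"
proof -
  have "Q * transpose_mat Q = 1\<^sub>m n"
    using Q mat_mult_left_right_inverse by (metis transpose_carrier_mat)
  then show ?thesis
    using orthogonal_conjugate_quadratic_form[OF Q(1) v, of "\<lambda>_. 1"] Q(1) v by simp
qed

text \<open>Orthogonality turns the factorization into \<open>B * Q = Q * mat_diag n d\<close>, to
  be read column by column. A column of \<open>Q\<close> is nonzero because it has length 1.\<close>

lemma diagonalization_eigenvector:
  fixes Q :: "real mat"
  assumes Q: "Q \<in> carrier_mat n n" "transpose_mat Q * Q = 1\<^sub>m n" and i: "i < n"
    and B: "B = Q * mat_diag n d * transpose_mat Q"
  shows "eigenvector B (col Q i) (d i)"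
proof -
  have Bc: "B \<in> carrier_mat n n" using Q(1) B by (simp add: square_mult_simps[where n = n])
  have "B * Q = Q * mat_diag n d * (transpose_mat Q * Q)"
    unfolding B using Q(1) by (simp add: square_mult_simps[where n = n])
  also have "\<dots> = Q * mat_diag n d" using Q by (simp add: square_mult_simps[where n = n])
  finally have "B *\<^sub>v col Q i = col (Q * mat_diag n d) i"
    using col_mult2[OF Bc Q(1) i] by metis
  also have "\<dots> = d i \<cdot>\<^sub>v col Q i"
    using Q(1) i by (intro eq_vecI) (auto simp: mat_diag_mult_right[of _ n n])
  finally have "B *\<^sub>v col Q i = d i \<cdot>\<^sub>v col Q i" .
  moreover have "scalar_prod (col Q i) (col Q i) = (transpose_mat Q * Q) $$ (i, i)"
    using i Q(1) by simp
  then have "col Q i \<noteq> 0\<^sub>v n" using i Q by auto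
  moreover have "col Q i \<in> carrier_vec n" using Q(1) by auto
  ultimately show ?thesis using Bc by (simp add: eigenvector_def)
qed

text \<open>The root has the same eigenvectors and the square roots of the eigenvalues, which are
  positive because \<open>W\<close> is positive on each column of \<open>Q\<close>.\<close>

lemma spd_sqrt_exists:
  assumes W: "spd_mat n W"
  obtains R where "spd_mat n R" "R * R = W"
proof -
  have Wc: "W \<in> carrier_mat n n" "transpose_mat W = W"
    and pos: "\<And>v. v \<in> carrier_vec n \<Longrightarrow> v \<noteq> 0\<^sub>v n \<Longrightarrow> 0 < scalar_prod v (W *\<^sub>v v)"
    using W by (auto simp: spd_mat_def sym_mat_def)
  obtain Q d where Q: "Q \<in> carrier_mat n n" "transpose_mat Q * Q = 1\<^sub>m n"
    and Wd: "W = Q * mat_diag n d * transpose_mat Q"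
    using real_spectral_theorem[OF Wc] by blast
  have d: "0 < d i" if "i < n" for i
  proof -
    have ev: "eigenvector W (col Q i) (d i)" by (rule diagonalization_eigenvector[OF Q that Wd])
    then have "0 < d i * scalar_prod (col Q i) (col Q i)"
      using pos[of "col Q i"] Wc Q(1) by (auto simp: eigenvector_def)
    then show ?thesis using scalar_prod_self_nonneg[of "col Q i"]
      by (simp add: zero_less_mult_iff)
  qed
  define R where "R = Q * mat_diag n (\<lambda>i. sqrt (d i)) * transpose_mat Q"
  have Rc: "R \<in> carrier_mat n n" using Q(1) by (simp add: R_def square_mult_simps[where n = n])
  have dt: "transpose_mat (mat_diag n f) = mat_diag n f" for f :: "nat \<Rightarrow> real"
    by (intro eq_matI) (auto simp: mat_diag_def)
  have "transpose_mat R = R"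
    unfolding R_def using Q(1)
    by (simp add: transpose_mult[of _ n n _ n] dt square_mult_simps[where n = n])
  moreover have "0 < scalar_prod v (R *\<^sub>v v)" if v: "v \<in> carrier_vec n" "v \<noteq> 0\<^sub>v n" for v
  proof -
    let ?w = "transpose_mat Q *\<^sub>v v"
    have "0 < scalar_prod v v"
      using scalar_prod_self_eq_0[OF v(1)] v(2) scalar_prod_self_nonneg[of v] by simp
    \<comment> \<open>A nonzero vector has a nonzero coordinate in the eigenbasis, since the squares
      of these coordinates sum to its squared length. That single term makes the quadratic form
      strictly positive.\<close>
    then obtain i where "i < n" "(?w $ i)\<^sup>2 \<noteq> 0"
      using orthogonal_transpose_norm[OF Q v(1)]
      by (metis lessThan_iff order_less_irrefl sum.neutral)
    then have "0 < (\<Sum>i<n. sqrt (d i) * (?w $ i)\<^sup>2)"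
      using d by (intro sum_pos2[of _ i]) (auto simp: less_imp_le)
    then show ?thesis
      unfolding R_def orthogonal_conjugate_quadratic_form[OF Q(1) v(1)] .
  qed
  ultimately have "spd_mat n R" using Rc by (auto simp: spd_mat_def sym_mat_def)
  moreover have "R * R = W"
  proof -
    have "R * R = Q * mat_diag n (\<lambda>i. sqrt (d i)) * (transpose_mat Q * Q)
        * mat_diag n (\<lambda>i. sqrt (d i)) * transpose_mat Q"
      unfolding R_def using Q(1) by (simp add: square_mult_simps[where n = n])
    also have "\<dots> = Q * (mat_diag n (\<lambda>i. sqrt (d i)) * mat_diag n (\<lambda>i. sqrt (d i))) * transpose_mat Q"
      using Q by (simp add: square_mult_simps[where n = n] del: mat_diag_diag)
    also have "mat_diag n (\<lambda>i. sqrt (d i)) * mat_diag n (\<lambda>i. sqrt (d i)) = mat_diag n d"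
      unfolding mat_diag_diag using d
      by (intro eq_matI) (auto simp: mat_diag_def less_imp_le)
    finally show ?thesis using Wd by simp
  qed
  ultimately show thesis by (rule that)
qed

lemma spd_sqrt_unique:
  assumes R: "spd_mat n R" and T: "spd_mat n T" and eq: "R * R = T * T"
  shows "R = T"
proof -
  have Rc: "R \<in> carrier_mat n n" "transpose_mat R = R"
    and Tc: "T \<in> carrier_mat n n" "transpose_mat T = T"
    using R T by (auto simp: spd_mat_def sym_mat_def)
  define D where "D = R - T"
  have D: "D \<in> carrier_mat n n" "transpose_mat D = D"
    using Rc Tc by (auto simp: D_def transpose_minus[of _ n n])
  txt \<open>Tested on an eigenvector of \<open>D\<close>, the identity \<open>R D + D T = 0\<close> forces its eigenvalue to vanish.\<close>
  have "R * D + D * T = R * R - T * T"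
    using Rc(1) Tc(1) unfolding D_def
    by (simp add: mult_minus_distrib_mat[of _ n n _ n] minus_mult_distrib_mat[of _ n n _ _ n])
       (intro eq_matI, auto)
  then have zero: "R * D + D * T = 0\<^sub>m n n" using eq Tc by (auto intro!: eq_matI)
  obtain Q d where Q: "Q \<in> carrier_mat n n" "transpose_mat Q * Q = 1\<^sub>m n"
    and Dd: "D = Q * mat_diag n d * transpose_mat Q"
    using real_spectral_theorem[OF D] by blast
  have d0: "d i = 0" if "i < n" for i
  proof -
    have ev: "eigenvector D (col Q i) (d i)" by (rule diagonalization_eigenvector[OF Q that Dd])
    define v where "v = col Q i"
    have v: "v \<in> carrier_vec n" "v \<noteq> 0\<^sub>v n" "D *\<^sub>v v = d i \<cdot>\<^sub>v v"
      using ev D by (auto simp: eigenvector_def v_def)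
    have "0 = scalar_prod v ((R * D + D * T) *\<^sub>v v)" using v zero by (simp add: zero_mat_mult_vec)
    also have "\<dots> = scalar_prod v (R *\<^sub>v (D *\<^sub>v v)) + scalar_prod v (D *\<^sub>v (T *\<^sub>v v))"
      using Rc(1) Tc(1) D(1) v(1)
      by (simp add: add_mult_distrib_mat_vec[of _ n n] assoc_mult_mat_vec[of _ n n _ n]
          scalar_prod_add_distrib[of _ n])
    also have "scalar_prod v (D *\<^sub>v (T *\<^sub>v v)) = scalar_prod (D *\<^sub>v v) (T *\<^sub>v v)"
      using D Tc v by (intro symmetric_scalar_prod) auto
    also have "scalar_prod v (R *\<^sub>v (D *\<^sub>v v)) + \<dots>
        = d i * (scalar_prod v (R *\<^sub>v v) + scalar_prod v (T *\<^sub>v v))"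
      using v Rc Tc by (simp add: mult_mat_vec[of _ n n] algebra_simps)
    finally have "d i * (scalar_prod v (R *\<^sub>v v) + scalar_prod v (T *\<^sub>v v)) = 0" by simp
    moreover have "0 < scalar_prod v (R *\<^sub>v v) + scalar_prod v (T *\<^sub>v v)"
      using R T v by (auto simp: spd_mat_def intro!: add_pos_pos)
    ultimately show ?thesis by simp
  qed
  have "mat_diag n d = 0\<^sub>m n n" using d0 by (intro eq_matI) (auto simp: mat_diag_def)
  then have "D = 0\<^sub>m n n" using Dd Q(1) by simp
  show ?thesis
  proof (rule eq_matI)
    fix i j assume "i < dim_row T" "j < dim_col T"
    then show "R $$ (i, j) = T $$ (i, j)"
      using arg_cong[OF \<open>D = 0\<^sub>m n n\<close>, of "\<lambda>M. M $$ (i, j)"] Rc Tc by (simp add: D_def)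
  qed (use Rc Tc in auto)
qed

text \<open>Existence and uniqueness together make the definite description in
  \<open>mat_sqrt\<close> denote.\<close>

lemma mat_sqrt_spd:
  assumes "spd_mat n W"
  shows "spd_mat n (mat_sqrt W)" "mat_sqrt W * mat_sqrt W = W"
proof -
  have dim: "dim_row W = n" using assms by (auto simp: spd_mat_def)
  obtain R where R: "spd_mat n R" "R * R = W" using spd_sqrt_exists[OF assms] by blast
  have "spd_mat (dim_row W) (mat_sqrt W) \<and> mat_sqrt W * mat_sqrt W = W"
    unfolding mat_sqrt_def by (rule theI[of _ R]) (use R dim spd_sqrt_unique in auto)
  then show "spd_mat n (mat_sqrt W)" "mat_sqrt W * mat_sqrt W = W" using dim by auto
qed

lemma spd_det_nonzero:
  assumes "spd_mat n W"
  shows "det W \<noteq> 0"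
proof
  assume "det W = 0"
  moreover have W: "W \<in> carrier_mat n n" using assms by (simp add: spd_mat_def)
  ultimately obtain v where "v \<in> carrier_vec n" "v \<noteq> 0\<^sub>v n" "W *\<^sub>v v = 0\<^sub>v n"
    using det_0_iff_vec_prod_zero_field[OF W] by blast
  then show False using assms by (force simp: spd_mat_def)
qed

text \<open>\<open>Min\<close> is attained only on a finite nonempty set. Finiteness comes from the
  spectrum, nonemptiness from symmetry and positive dimension.\<close>

lemma lambda_min_eigenvalue:
  fixes B :: "real mat"
  assumes B: "B \<in> carrier_mat n n" "transpose_mat B = B" and n: "0 < n"
  shows "eigenvalue B (lambda_min B)"
proof -
  have "finite {l. eigenvalue B l}"
    using card_finite_spectrum(1)[OF B(1)] by (simp add: spectrum_def)
  moreover have "{l. eigenvalue B l} \<noteq> {}"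
    using symmetric_real_eigenvalue_exists[OF B n] by blast
  ultimately show ?thesis using Min_in unfolding lambda_min_def by blast
qed

text \<open>Rayleigh bound: in eigenbasis coordinates the form is a weighted sum of squares, and
  each weight is an eigenvalue, hence at least the smallest one.\<close>

lemma lambda_min_quadratic_form:
  fixes B :: "real mat"
  assumes B: "B \<in> carrier_mat n n" "transpose_mat B = B" and v: "v \<in> carrier_vec n"
  shows "lambda_min B * scalar_prod v v \<le> scalar_prod v (B *\<^sub>v v)"
proof -
  obtain Q d where Q: "Q \<in> carrier_mat n n" "transpose_mat Q * Q = 1\<^sub>m n"
    and Bd: "B = Q * mat_diag n d * transpose_mat Q"
    using real_spectral_theorem[OF B] by blast
  have fin: "finite {l. eigenvalue B l}"
    using card_finite_spectrum(1)[OF B(1)] by (simp add: spectrum_def)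
  have "lambda_min B \<le> d i" if "i < n" for i
    unfolding lambda_min_def
    using diagonalization_eigenvector[OF Q that Bd] by (intro Min_le[OF fin]) (auto simp: eigenvalue_def)
  then have "(\<Sum>i<n. lambda_min B * ((transpose_mat Q *\<^sub>v v) $ i)\<^sup>2)
      \<le> (\<Sum>i<n. d i * ((transpose_mat Q *\<^sub>v v) $ i)\<^sup>2)"
    by (intro sum_mono mult_right_mono) auto
  moreover have "scalar_prod v (B *\<^sub>v v) = (\<Sum>i<n. d i * ((transpose_mat Q *\<^sub>v v) $ i)\<^sup>2)"
    unfolding Bd by (rule orthogonal_conjugate_quadratic_form[OF Q(1) v])
  ultimately show ?thesis
    using orthogonal_transpose_norm[OF Q v] by (simp add: sum_distrib_left[symmetric])
qed

section \<open>Euclidean norm, and the operator norm expressed through bilinear forms\<close>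

lemma euclid_norm_nonneg [simp]: "0 \<le> euclid_norm v"
  by (simp add: euclid_norm_def scalar_prod_self_nonneg)

lemma euclid_norm_square: "(euclid_norm v)\<^sup>2 = scalar_prod v v"
  by (simp add: euclid_norm_def scalar_prod_self_nonneg)

lemma euclid_norm_eq_0:
  assumes "v \<in> carrier_vec n"
  shows "euclid_norm v = 0 \<longleftrightarrow> v = 0\<^sub>v n"
  using scalar_prod_self_eq_0[OF assms] by (simp add: euclid_norm_def)

lemma scalar_prod_le_euclid_norm:
  assumes "u \<in> carrier_vec n" "v \<in> carrier_vec n"
  shows "\<bar>scalar_prod u v\<bar> \<le> euclid_norm u * euclid_norm v"
proof -
  have norm: "euclid_norm w = L2_set (\<lambda>i. w $ i) {0..<n}" if "w \<in> carrier_vec n" for w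
    using that by (simp add: euclid_norm_def L2_set_def scalar_prod_def power2_eq_square)
  have "\<bar>scalar_prod u v\<bar> \<le> (\<Sum>i = 0..<n. \<bar>u $ i\<bar> * \<bar>v $ i\<bar>)"
    using assms by (auto simp: scalar_prod_def abs_mult[symmetric] intro: sum_abs)
  also have "\<dots> \<le> euclid_norm u * euclid_norm v"
    using L2_set_mult_ineq assms by (simp add: norm)
  finally show ?thesis .
qed

text \<open>The constant in the proof is the Frobenius norm, by Cauchy-Schwarz on each row. Some
  finite bound must be known before the supremum in \<open>op_norm\<close> can be used as an upper
  bound.\<close>

lemma euclid_norm_mult_bounded:
  assumes Y: "Y \<in> carrier_mat n n"
  obtains c where "\<And>v. v \<in> carrier_vec n \<Longrightarrow> euclid_norm (Y *\<^sub>v v) \<le> c * euclid_norm v"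
proof -
  define c where "c = sqrt (\<Sum>i<n. (euclid_norm (row Y i))\<^sup>2)"
  have "euclid_norm (Y *\<^sub>v v) \<le> c * euclid_norm v" if v: "v \<in> carrier_vec n" for v
  proof -
    have "scalar_prod (Y *\<^sub>v v) (Y *\<^sub>v v) = (\<Sum>i<n. (scalar_prod (row Y i) v)\<^sup>2)"
      using Y by (simp add: scalar_prod_def[of "Y *\<^sub>v v"] lessThan_atLeast0 power2_eq_square)
    also have "\<dots> \<le> (\<Sum>i<n. (euclid_norm (row Y i))\<^sup>2 * (euclid_norm v)\<^sup>2)"
    proof (rule sum_mono)
      fix i assume "i \<in> {..<n}"
      then have "\<bar>scalar_prod (row Y i) v\<bar> \<le> euclid_norm (row Y i) * euclid_norm v"
        using Y v by (intro scalar_prod_le_euclid_norm[of _ n]) auto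
      from power_mono[OF this, of 2]
      show "(scalar_prod (row Y i) v)\<^sup>2 \<le> (euclid_norm (row Y i))\<^sup>2 * (euclid_norm v)\<^sup>2"
        by (simp add: power_mult_distrib)
    qed
    also have "\<dots> = (c * euclid_norm v)\<^sup>2"
      by (simp add: c_def sum_distrib_right power_mult_distrib sum_nonneg)
    finally have "(euclid_norm (Y *\<^sub>v v))\<^sup>2 \<le> (c * euclid_norm v)\<^sup>2"
      by (simp add: euclid_norm_square)
    then show ?thesis by (rule power2_le_imp_le) (simp add: c_def sum_nonneg)
  qed
  then show thesis by (rule that)
qed

lemma euclid_norm_mult_le_op_norm:
  assumes Y: "Y \<in> carrier_mat n n" and v: "v \<in> carrier_vec n"
  shows "euclid_norm (Y *\<^sub>v v) \<le> op_norm Y * euclid_norm v"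
proof (cases "v = 0\<^sub>v n")
  case True
  then show ?thesis using Y by (simp add: euclid_norm_def mult_mat_zero_vec[of _ n n])
next
  case False
  obtain c where c: "\<And>v. v \<in> carrier_vec n \<Longrightarrow> euclid_norm (Y *\<^sub>v v) \<le> c * euclid_norm v"
    using euclid_norm_mult_bounded[OF Y] by blast
  have pos: "0 < euclid_norm w" if "w \<in> carrier_vec n" "w \<noteq> 0\<^sub>v n" for w
    using euclid_norm_eq_0[OF that(1)] that(2) euclid_norm_nonneg[of w] by linarith
  have "euclid_norm (Y *\<^sub>v v) / euclid_norm v \<le> op_norm Y"
    unfolding op_norm_def using Y v False c pos
    by (intro cSUP_upper bdd_aboveI2[of _ _ c]) (auto simp: divide_le_eq)
  then show ?thesis using pos[OF v False] by (simp add: divide_le_eq)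
qed

text \<open>Positive dimension supplies a nonzero vector, so that the supremum ranges over a
  nonempty set.\<close>

lemma op_norm_le:
  assumes Y: "Y \<in> carrier_mat n n" and n: "0 < n"
    and le: "\<And>v. v \<in> carrier_vec n \<Longrightarrow> euclid_norm (Y *\<^sub>v v) \<le> c * euclid_norm v"
  shows "op_norm Y \<le> c"
proof -
  have "unit_vec n 0 \<noteq> (0\<^sub>v n :: real Matrix.vec)"
    using n by (metis index_unit_vec(1) index_zero_vec(1) zero_neq_one)
  then have ne: "{v \<in> carrier_vec (dim_col Y). v \<noteq> 0\<^sub>v (dim_col Y)} \<noteq> ({} :: real Matrix.vec set)"
    using Y unit_vec_carrier[of n 0] unfolding carrier_matD(2)[OF Y] by blast
  have "euclid_norm (Y *\<^sub>v v) / euclid_norm v \<le> c"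
    if "v \<in> carrier_vec n" "v \<noteq> 0\<^sub>v n" for v
    using le[OF that(1)] euclid_norm_eq_0[OF that(1)] that(2) order_less_le[of 0 "euclid_norm v"]
    by (simp add: divide_le_eq)
  then show ?thesis unfolding op_norm_def using Y by (intro cSUP_least[OF ne]) auto
qed

lemma op_norm_nonneg:
  assumes Y: "Y \<in> carrier_mat n n" and n: "0 < n"
  shows "0 \<le> op_norm Y"
proof -
  have u: "unit_vec n 0 \<in> carrier_vec n" by simp
  have "euclid_norm (unit_vec n 0) = 1" using n by (simp add: euclid_norm_def)
  then show ?thesis
    using order_trans[OF euclid_norm_nonneg euclid_norm_mult_le_op_norm[OF Y u]] by simp
qed

lemma op_norm_mult_le:
  assumes "X \<in> carrier_mat n n" "Y \<in> carrier_mat n n" "0 < n"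
  shows "op_norm (X * Y) \<le> op_norm X * op_norm Y"
proof (rule op_norm_le)
  fix v :: "real Matrix.vec" assume v: "v \<in> carrier_vec n"
  have "euclid_norm (X * Y *\<^sub>v v) \<le> op_norm X * euclid_norm (Y *\<^sub>v v)"
    using euclid_norm_mult_le_op_norm[OF assms(1), of "Y *\<^sub>v v"] assms v by simp
  also have "\<dots> \<le> op_norm X * (op_norm Y * euclid_norm v)"
    using euclid_norm_mult_le_op_norm[OF assms(2) v] op_norm_nonneg[OF assms(1,3)]
    by (intro mult_left_mono) auto
  finally show "euclid_norm (X * Y *\<^sub>v v) \<le> op_norm X * op_norm Y * euclid_norm v"
    by (simp add: mult.assoc)
qed (use assms in auto)

lemma op_norm_one_le: "0 < n \<Longrightarrow> op_norm (1\<^sub>m n) \<le> 1"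
  by (rule op_norm_le) auto

text \<open>Cauchy-Schwarz followed by the arithmetic-geometric mean inequality. The product of
  norms is traded for a sum of squares because |Q u|^2 is linear in an orthogonal projection Q,
  while |Q u| |Q v| is not.\<close>

lemma bilinear_le_op_norm:
  assumes "Y \<in> carrier_mat n n" "u \<in> carrier_vec n" "v \<in> carrier_vec n" "0 < n"
  shows "scalar_prod u (Y *\<^sub>v v) \<le> op_norm Y / 2 * (scalar_prod u u + scalar_prod v v)"
proof -
  have "scalar_prod u (Y *\<^sub>v v) \<le> euclid_norm u * euclid_norm (Y *\<^sub>v v)"
    using scalar_prod_le_euclid_norm[of u n "Y *\<^sub>v v"] assms by auto
  also have "\<dots> \<le> euclid_norm u * (op_norm Y * euclid_norm v)"
    using euclid_norm_mult_le_op_norm assms by (intro mult_left_mono) auto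
  also have "\<dots> = op_norm Y * (euclid_norm u * euclid_norm v)" by simp
  also have "\<dots> \<le> op_norm Y * (((euclid_norm u)\<^sup>2 + (euclid_norm v)\<^sup>2) / 2)"
    using sum_squares_bound[of "euclid_norm u" "euclid_norm v"] op_norm_nonneg[OF assms(1,4)]
    by (intro mult_left_mono) auto
  finally show ?thesis by (simp add: euclid_norm_square)
qed

text \<open>The converse of the preceding bound. Nothing is lost by passing to the sum of squares,
  because \<open>u\<close> may be rescaled to the length of \<open>v\<close>, where both means
  agree.\<close>

lemma op_norm_le_bilinear:
  assumes Y: "Y \<in> carrier_mat n n" and n: "0 < n" and c: "0 \<le> c"
    and le: "\<And>u v. u \<in> carrier_vec n \<Longrightarrow> v \<in> carrier_vec n \<Longrightarrow>
      scalar_prod u (Y *\<^sub>v v) \<le> c / 2 * (scalar_prod u u + scalar_prod v v)"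
  shows "op_norm Y \<le> c"
proof (rule op_norm_le[OF Y n])
  fix v :: "real Matrix.vec" assume v: "v \<in> carrier_vec n"
  define y where "y = euclid_norm (Y *\<^sub>v v)"
  show "y \<le> c * euclid_norm v"
  proof (cases "y = 0")
    case True
    then show ?thesis using c by simp
  next
    case False
    have y: "0 < y" using False by (simp add: y_def order_less_le)
    \<comment> \<open>This factor gives \<open>t \<cdot>\<^sub>v (Y *\<^sub>v v)\<close> the length
      of \<open>v\<close>, so the bound becomes |v| y \<le> c |v|^2.\<close>
    define t where "t = euclid_norm v / y"
    have Yv: "Y *\<^sub>v v \<in> carrier_vec n" using Y v by simp
    have yy: "scalar_prod (Y *\<^sub>v v) (Y *\<^sub>v v) = y\<^sup>2" by (simp add: y_def euclid_norm_square)
    have vv: "scalar_prod v v = (euclid_norm v)\<^sup>2" by (simp add: euclid_norm_square)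
    have "scalar_prod (t \<cdot>\<^sub>v (Y *\<^sub>v v)) (Y *\<^sub>v v)
        \<le> c / 2 * (scalar_prod (t \<cdot>\<^sub>v (Y *\<^sub>v v)) (t \<cdot>\<^sub>v (Y *\<^sub>v v)) + scalar_prod v v)"
      using le[of "t \<cdot>\<^sub>v (Y *\<^sub>v v)" v] Yv v by simp
    also have "scalar_prod (t \<cdot>\<^sub>v (Y *\<^sub>v v)) (Y *\<^sub>v v) = t * y\<^sup>2" using Yv by (simp add: yy)
    also have "scalar_prod (t \<cdot>\<^sub>v (Y *\<^sub>v v)) (t \<cdot>\<^sub>v (Y *\<^sub>v v)) = t * (t * y\<^sup>2)"
      using Yv by (simp add: yy)
    finally have "euclid_norm v * y \<le> euclid_norm v * (c * euclid_norm v)"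
      using y by (simp add: t_def vv power2_eq_square ac_simps)
    moreover have "euclid_norm v \<noteq> 0"
      using euclid_norm_eq_0[OF v] False Y by (auto simp: y_def euclid_norm_def mult_mat_zero_vec[of _ n n])
    ultimately show ?thesis using euclid_norm_nonneg[of v] by (simp add: mult_le_cancel_left)
  qed
qed

section \<open>Projections onto column spaces\<close>

text \<open>For linearly independent columns this is the orthogonal projection onto their span. If
  the Gram matrix is singular, \<open>mat_inv\<close> makes it the zero matrix, which is again an
  orthogonal projection.\<close>

definition column_projection :: "real mat \<Rightarrow> real mat" where
  "column_projection V = V * mat_inv (transpose_mat V * V) * transpose_mat V"

lemma mat_inv_gram:
  assumes V: "V \<in> carrier_mat n q"
  shows "mat_inv (transpose_mat V * V) \<in> carrier_mat q q"
    "transpose_mat (mat_inv (transpose_mat V * V)) = mat_inv (transpose_mat V * V)"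
proof -
  have c: "transpose_mat V * V \<in> carrier_mat q q" using V by simp
  show "mat_inv (transpose_mat V * V) \<in> carrier_mat q q" using c by simp
  have "transpose_mat (transpose_mat V * V) = transpose_mat V * V"
    using V by (simp add: transpose_mult[of _ q n _ q])
  then show "transpose_mat (mat_inv (transpose_mat V * V)) = mat_inv (transpose_mat V * V)"
    by (rule mat_inv_sym[OF c])
qed

lemma column_projection_sym:
  assumes V: "V \<in> carrier_mat n q"
  shows "transpose_mat (column_projection V) = column_projection V"
proof -
  define H where "H = mat_inv (transpose_mat V * V)"
  have H: "H \<in> carrier_mat q q" "transpose_mat H = H"
    using mat_inv_gram[OF V] by (simp_all add: H_def)
  have VH: "V * H \<in> carrier_mat n q" using V H(1) by simp
  have "transpose_mat (V * H * transpose_mat V) = V * transpose_mat (V * H)"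
    using transpose_mult[OF VH, of "transpose_mat V" n] V by simp
  also have "transpose_mat (V * H) = H * transpose_mat V"
    using transpose_mult[OF V H(1)] H(2) by simp
  also have "V * (H * transpose_mat V) = V * H * transpose_mat V"
    by (rule assoc_mult_mat[symmetric, of _ n q _ q _ n]) (use V H in auto)
  finally show ?thesis by (simp add: column_projection_def H_def)
qed

text \<open>Everything reduces to H G H = H for the Gram matrix G and H = \<open>mat_inv G\<close>.
  This holds both for a true inverse and for the placeholder zero.\<close>

lemma column_projection_idem:
  assumes V: "V \<in> carrier_mat n q"
  shows "column_projection V * column_projection V = column_projection V"
proof -
  define G where "G = transpose_mat V * V"
  have G: "G \<in> carrier_mat q q" "mat_inv G \<in> carrier_mat q q" using V by (auto simp: G_def)
  have "column_projection V * column_projection V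
      = V * (mat_inv G * (transpose_mat V * (V * (mat_inv G * transpose_mat V))))"
    unfolding column_projection_def G_def[symmetric] using V G
    by (simp add: assoc_mult_mat[of _ n q _ q _ n] assoc_mult_mat[of _ n q _ n _ n]
        assoc_mult_mat[of _ q q _ n _ n] mult_carrier_mat[of _ q n _ n]
        mult_carrier_mat[of _ q q _ n])
  also have "transpose_mat V * (V * (mat_inv G * transpose_mat V)) = G * (mat_inv G * transpose_mat V)"
    unfolding G_def
    by (rule assoc_mult_mat[symmetric, of _ q n _ q _ n])
      (use V G in \<open>auto simp: G_def[symmetric] mult_carrier_mat[of _ q q _ n]\<close>)
  also have "mat_inv G * (G * (mat_inv G * transpose_mat V)) = mat_inv G * G * mat_inv G * transpose_mat V"
    using V G by (simp add: assoc_mult_mat[of _ q q _ q _ n] assoc_mult_mat[of _ q q _ q _ q]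
        mult_carrier_mat[of _ q q _ n])
  also have "mat_inv G * G * mat_inv G = mat_inv G"
  proof (cases "det G = 0")
    case True
    then show ?thesis using mat_inv_singular[OF G(1)] G by simp
  next
    case False
    show ?thesis unfolding mat_inv_regular(2)[OF G(1) False] using G by (intro left_mult_one_mat)
  qed
  also have "V * (mat_inv G * transpose_mat V) = column_projection V"
    unfolding column_projection_def G_def[symmetric] using V G
    by (simp add: assoc_mult_mat[of _ n q _ q _ n])
  finally show ?thesis .
qed

lemma trace_mult_comm:
  fixes X Y :: "real mat"
  assumes X: "X \<in> carrier_mat n q" and Y: "Y \<in> carrier_mat q n"
  shows "(\<Sum>i<n. (X * Y) $$ (i, i)) = (\<Sum>j<q. (Y * X) $$ (j, j))"
proof -
  have "(\<Sum>i<n. (X * Y) $$ (i, i)) = (\<Sum>i<n. \<Sum>j<q. X $$ (i, j) * Y $$ (j, i))"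
    using X Y by (intro sum.cong) (auto simp: scalar_prod_def lessThan_atLeast0)
  also have "\<dots> = (\<Sum>j<q. \<Sum>i<n. Y $$ (j, i) * X $$ (i, j))"
    by (subst sum.swap) (simp add: mult.commute)
  also have "\<dots> = (\<Sum>j<q. (Y * X) $$ (j, j))"
    using X Y by (intro sum.cong) (auto simp: scalar_prod_def lessThan_atLeast0)
  finally show ?thesis .
qed

text \<open>Cyclicity turns the trace into that of \<open>mat_inv G * G\<close>, which is the
  identity of size \<open>q\<close> or zero. The zero case is why an inequality is stated.\<close>

lemma column_projection_trace_le:
  assumes V: "V \<in> carrier_mat n q"
  shows "(\<Sum>i<n. column_projection V $$ (i, i)) \<le> real q"
proof -
  define G where "G = transpose_mat V * V"
  have G: "G \<in> carrier_mat q q" "mat_inv G \<in> carrier_mat q q" using V by (auto simp: G_def)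
  have "(\<Sum>i<n. column_projection V $$ (i, i)) = (\<Sum>i<n. (V * (mat_inv G * transpose_mat V)) $$ (i, i))"
    unfolding column_projection_def G_def[symmetric] using V G
    by (simp add: assoc_mult_mat[of _ n q _ q _ n])
  also have "\<dots> = (\<Sum>j<q. (mat_inv G * transpose_mat V * V) $$ (j, j))"
    by (rule trace_mult_comm) (use V G in \<open>auto simp: mult_carrier_mat[of _ q q _ n]\<close>)
  also have "mat_inv G * transpose_mat V * V = mat_inv G * G"
    unfolding G_def by (rule assoc_mult_mat[of _ q q _ n _ q]) (use V G in \<open>auto simp: G_def[symmetric]\<close>)
  also have "(\<Sum>j<q. (mat_inv G * G) $$ (j, j)) \<le> real q"
  proof (cases "det G = 0")
    case True
    then show ?thesis unfolding mat_inv_singular[OF G(1) True] using G by simp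
  next
    case False
    then show ?thesis unfolding mat_inv_regular(2)[OF G(1) False] by simp
  qed
  finally show ?thesis .
qed

text \<open>Symmetry and idempotence give P_ii as the sum of the squares P_ik^2. Hence P_ii^2 \<le>
  P_ii, so P_ii \<le> 1, and P_ij^2 \<le> P_ii. The bound is uniform in \<open>P\<close> and is the
  source of all integrability of the iterates.\<close>

lemma projection_entry_bound:
  fixes P :: "real mat"
  assumes P: "P \<in> carrier_mat n n" "transpose_mat P = P" "P * P = P" and ij: "i < n" "j < n"
  shows "\<bar>P $$ (i, j)\<bar> \<le> 1"
proof -
  have sym: "P $$ (k, i) = P $$ (i, k)" if "k < n" for k
    using index_transpose_mat(1)[of k P i, unfolded P(2)] P(1) ij that by auto
  have "P $$ (i, i) = (P * P) $$ (i, i)" using P(3) by simp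
  also have "\<dots> = (\<Sum>k<n. P $$ (i, k) * P $$ (k, i))"
    using P(1) ij by (simp add: scalar_prod_def lessThan_atLeast0)
  also have "\<dots> = (\<Sum>k<n. (P $$ (i, k))\<^sup>2)"
    using sym by (intro sum.cong) (auto simp: power2_eq_square)
  finally have s: "P $$ (i, i) = (\<Sum>k<n. (P $$ (i, k))\<^sup>2)" .
  have le: "(P $$ (i, k))\<^sup>2 \<le> P $$ (i, i)" if "k < n" for k
    unfolding s using that by (intro member_le_sum) auto
  have "P $$ (i, i) \<le> 1"
  proof (rule ccontr)
    assume "\<not> ?thesis"
    then have "P $$ (i, i) * 1 < P $$ (i, i) * P $$ (i, i)" by (intro mult_strict_left_mono) auto
    with le[OF ij(1)] show False by (simp add: power2_eq_square)
  qed
  then have "(P $$ (i, j))\<^sup>2 \<le> 1" using le[OF ij(2)] by simp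
  then show ?thesis by (simp add: abs_square_le_1)
qed

lemma projection_scalar_prod:
  fixes P :: "real mat"
  assumes P: "P \<in> carrier_mat n n" "transpose_mat P = P" "P * P = P" and u: "u \<in> carrier_vec n"
  shows "scalar_prod (P *\<^sub>v u) (P *\<^sub>v u) = scalar_prod u (P *\<^sub>v u)"
proof -
  have "scalar_prod (P *\<^sub>v u) (P *\<^sub>v u) = scalar_prod u (P *\<^sub>v (P *\<^sub>v u))"
    by (rule symmetric_scalar_prod[symmetric]) (use P u in auto)
  also have "P *\<^sub>v (P *\<^sub>v u) = P *\<^sub>v u"
    using P u by (simp add: assoc_mult_mat_vec[symmetric, of _ n n _ n])
  finally show ?thesis .
qed

lemma complement_projection:
  fixes P :: "real mat"
  assumes P: "P \<in> carrier_mat n n" "transpose_mat P = P" "P * P = P"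
  shows "1\<^sub>m n - P \<in> carrier_mat n n" "transpose_mat (1\<^sub>m n - P) = 1\<^sub>m n - P"
    "(1\<^sub>m n - P) * (1\<^sub>m n - P) = 1\<^sub>m n - P"
proof -
  show c: "1\<^sub>m n - P \<in> carrier_mat n n" using P(1) by auto
  show "transpose_mat (1\<^sub>m n - P) = 1\<^sub>m n - P"
    using P(1) unfolding transpose_minus[OF one_carrier_mat P(1)] P(2) by simp
  have "(1\<^sub>m n - P) * (1\<^sub>m n - P) = 1\<^sub>m n * (1\<^sub>m n - P) - P * (1\<^sub>m n - P)"
    by (rule minus_mult_distrib_mat[OF one_carrier_mat P(1) c])
  also have "P * (1\<^sub>m n - P) = P * 1\<^sub>m n - P * P"
    by (rule mult_minus_distrib_mat[OF P(1) one_carrier_mat P(1)])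
  also have "\<dots> = 0\<^sub>m n n" unfolding P(3) using P(1) by (intro eq_matI) auto
  also have "1\<^sub>m n * (1\<^sub>m n - P) - 0\<^sub>m n n = 1\<^sub>m n - P"
    unfolding left_mult_one_mat[OF c] using P(1) by (intro eq_matI) auto
  finally show "(1\<^sub>m n - P) * (1\<^sub>m n - P) = 1\<^sub>m n - P" .
qed

section \<open>Measurability of matrix-valued maps\<close>

text \<open>Measurability is tested entrywise with dimensions constant on the whole space, so that
  algebraic operations reduce to sums and products of real functions. A sketch, whose width varies,
  fits this only after restriction to a fixed number of columns.\<close>

definition measurable_mat :: "nat \<Rightarrow> nat \<Rightarrow> 'w measure \<Rightarrow> ('w \<Rightarrow> real mat) \<Rightarrow> bool" where
  "measurable_mat m k M Y \<longleftrightarrow> (\<forall>\<omega> \<in> space M. Y \<omega> \<in> carrier_mat m k) \<and>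
     (\<forall>i < m. \<forall>j < k. (\<lambda>\<omega>. Y \<omega> $$ (i, j)) \<in> borel_measurable M)"

lemma measurable_matI:
  assumes "\<And>\<omega>. \<omega> \<in> space M \<Longrightarrow> Y \<omega> \<in> carrier_mat m k"
    and "\<And>i j. i < m \<Longrightarrow> j < k \<Longrightarrow> (\<lambda>\<omega>. Y \<omega> $$ (i, j)) \<in> borel_measurable M"
  shows "measurable_mat m k M Y"
  using assms by (auto simp: measurable_mat_def)

lemma measurable_matD:
  assumes "measurable_mat m k M Y"
  shows "\<And>\<omega>. \<omega> \<in> space M \<Longrightarrow> Y \<omega> \<in> carrier_mat m k"
    and "\<And>i j. i < m \<Longrightarrow> j < k \<Longrightarrow> (\<lambda>\<omega>. Y \<omega> $$ (i, j)) \<in> borel_measurable M"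
  using assms by (auto simp: measurable_mat_def)

lemma measurable_mat_const: "B \<in> carrier_mat m k \<Longrightarrow> measurable_mat m k M (\<lambda>_. B)"
  by (simp add: measurable_mat_def)

lemma measurable_mat_mult:
  assumes X: "measurable_mat m k M X" and Y: "measurable_mat k l M Y"
  shows "measurable_mat m l M (\<lambda>\<omega>. X \<omega> * Y \<omega>)"
proof (rule measurable_matI)
  show "X \<omega> * Y \<omega> \<in> carrier_mat m l" if "\<omega> \<in> space M" for \<omega>
    using measurable_matD(1)[OF X that] measurable_matD(1)[OF Y that] by simp
  fix i j assume ij: "i < m" "j < l"
  have "(\<lambda>\<omega>. \<Sum>r<k. X \<omega> $$ (i, r) * Y \<omega> $$ (r, j)) \<in> borel_measurable M"
    using measurable_matD(2)[OF X] measurable_matD(2)[OF Y] ij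
    by (intro borel_measurable_sum borel_measurable_times) auto
  also have "?this \<longleftrightarrow> (\<lambda>\<omega>. (X \<omega> * Y \<omega>) $$ (i, j)) \<in> borel_measurable M"
  proof (rule measurable_cong)
    fix \<omega> assume "\<omega> \<in> space M"
    from measurable_matD(1)[OF X this] measurable_matD(1)[OF Y this]
    show "(\<Sum>r<k. X \<omega> $$ (i, r) * Y \<omega> $$ (r, j)) = (X \<omega> * Y \<omega>) $$ (i, j)"
      using ij by (simp add: scalar_prod_def lessThan_atLeast0)
  qed
  finally show "(\<lambda>\<omega>. (X \<omega> * Y \<omega>) $$ (i, j)) \<in> borel_measurable M" .
qed

lemma measurable_mat_diff:
  assumes X: "measurable_mat m k M X" and Y: "measurable_mat m k M Y"
  shows "measurable_mat m k M (\<lambda>\<omega>. X \<omega> - Y \<omega>)"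
proof (rule measurable_matI)
  show "X \<omega> - Y \<omega> \<in> carrier_mat m k" if "\<omega> \<in> space M" for \<omega>
    using measurable_matD(1)[OF X that] measurable_matD(1)[OF Y that] by auto
  fix i j assume ij: "i < m" "j < k"
  have "(\<lambda>\<omega>. X \<omega> $$ (i, j) - Y \<omega> $$ (i, j)) \<in> borel_measurable M"
    using measurable_matD(2)[OF X ij] measurable_matD(2)[OF Y ij] by measurable
  also have "?this \<longleftrightarrow> (\<lambda>\<omega>. (X \<omega> - Y \<omega>) $$ (i, j)) \<in> borel_measurable M"
    using ij measurable_matD(1)[OF Y] by (intro measurable_cong) fastforce
  finally show "(\<lambda>\<omega>. (X \<omega> - Y \<omega>) $$ (i, j)) \<in> borel_measurable M" .
qed

lemma measurable_mat_transpose: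
  assumes X: "measurable_mat m k M X"
  shows "measurable_mat k m M (\<lambda>\<omega>. transpose_mat (X \<omega>))"
proof (rule measurable_matI)
  show "transpose_mat (X \<omega>) \<in> carrier_mat k m" if "\<omega> \<in> space M" for \<omega>
    using measurable_matD(1)[OF X that] by simp
  fix i j assume ij: "i < k" "j < m"
  have "(\<lambda>\<omega>. transpose_mat (X \<omega>) $$ (i, j)) \<in> borel_measurable M
      \<longleftrightarrow> (\<lambda>\<omega>. X \<omega> $$ (j, i)) \<in> borel_measurable M"
    using ij measurable_matD(1)[OF X] by (intro measurable_cong) fastforce
  then show "(\<lambda>\<omega>. transpose_mat (X \<omega>) $$ (i, j)) \<in> borel_measurable M"
    using measurable_matD(2)[OF X ij(2,1)] by simp
qed

text \<open>By the Leibniz formula the determinant is a polynomial in the entries.\<close>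

lemma measurable_det:
  assumes X: "measurable_mat m m M X"
  shows "(\<lambda>\<omega>. det (X \<omega>)) \<in> borel_measurable M"
proof -
  have "(\<lambda>\<omega>. \<Sum>p | p permutes {0..<m}. signof p * (\<Prod>i = 0..<m. X \<omega> $$ (i, p i)))
      \<in> borel_measurable M"
    using measurable_matD(2)[OF X]
    by (intro borel_measurable_sum borel_measurable_times borel_measurable_prod) auto
  also have "?this \<longleftrightarrow> ?thesis"
    by (intro measurable_cong) (rule det_def'[OF measurable_matD(1)[OF X], symmetric])
  finally show ?thesis .
qed

lemma measurable_mat_inv:
  assumes X: "measurable_mat m m M X"
  shows "measurable_mat m m M (\<lambda>\<omega>. mat_inv (X \<omega>))"
proof (rule measurable_matI)
  show "mat_inv (X \<omega>) \<in> carrier_mat m m" if "\<omega> \<in> space M" for \<omega>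
    using measurable_matD(1)[OF X that] by simp
  fix i j assume ij: "i < m" "j < m"
  note [measurable] = measurable_det[OF X]
  have "measurable_mat (m - 1) (m - 1) M (\<lambda>\<omega>. mat_delete (X \<omega>) j i)"
  proof (rule measurable_matI)
    show "mat_delete (X \<omega>) j i \<in> carrier_mat (m - 1) (m - 1)" if "\<omega> \<in> space M" for \<omega>
      using measurable_matD(1)[OF X that] by (auto simp: mat_delete_def)
    fix r s assume rs: "r < m - 1" "s < m - 1"
    \<comment> \<open>Deleting row \<open>j\<close> and column \<open>i\<close> shifts the later
      indices by one. The roles of \<open>i\<close> and \<open>j\<close> are exchanged because the
      adjugate is the transposed cofactor matrix.\<close>
    let ?r = "if r < j then r else Suc r" and ?s = "if s < i then s else Suc s"
    have "(\<lambda>\<omega>. mat_delete (X \<omega>) j i $$ (r, s)) \<in> borel_measurable M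
      \<longleftrightarrow> (\<lambda>\<omega>. X \<omega> $$ (?r, ?s)) \<in> borel_measurable M"
      using measurable_matD(1)[OF X] rs
      by (intro measurable_cong) (fastforce simp: mat_delete_def)
    moreover have "?r < m" "?s < m" using rs by auto
    ultimately show "(\<lambda>\<omega>. mat_delete (X \<omega>) j i $$ (r, s)) \<in> borel_measurable M"
      using measurable_matD(2)[OF X] by blast
  qed
  note [measurable] = measurable_det[OF this]
  have "(\<lambda>\<omega>. if det (X \<omega>) = 0 then 0
      else 1 / det (X \<omega>) * ((-1) ^ (j + i) * det (mat_delete (X \<omega>) j i))) \<in> borel_measurable M"
    by measurable
  also have "?this \<longleftrightarrow> (\<lambda>\<omega>. mat_inv (X \<omega>) $$ (i, j)) \<in> borel_measurable M"
  proof (rule measurable_cong)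
    fix \<omega> assume "\<omega> \<in> space M"
    from measurable_matD(1)[OF X this]
    show "(if det (X \<omega>) = 0 then 0
        else 1 / det (X \<omega>) * ((-1) ^ (j + i) * det (mat_delete (X \<omega>) j i))) = mat_inv (X \<omega>) $$ (i, j)"
      using ij by (simp add: mat_inv_eq_adj adj_mat_def cofactor_def)
  qed
  finally show "(\<lambda>\<omega>. mat_inv (X \<omega>) $$ (i, j)) \<in> borel_measurable M" .
qed

lemma measurable_mat_comp:
  assumes Y: "measurable_mat m k N Y" and f: "f \<in> measurable M N"
  shows "measurable_mat m k M (\<lambda>\<omega>. Y (f \<omega>))"
proof (rule measurable_matI)
  show "Y (f \<omega>) \<in> carrier_mat m k" if "\<omega> \<in> space M" for \<omega>
    using measurable_matD(1)[OF Y measurable_space[OF f that]] .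
  show "(\<lambda>\<omega>. Y (f \<omega>) $$ (i, j)) \<in> borel_measurable M" if "i < m" "j < k" for i j
    using measurable_compose[OF f measurable_matD(2)[OF Y that]] .
qed

section \<open>The measurable space of sketches with a random number of columns\<close>

lemma sketch_generators:
  "({carrier_mat n q | q. True} \<union>
      {{S \<in> carrier_mat n q. S $$ (i, j) \<in> B} | q i j B. i < n \<and> j < q \<and> B \<in> sets borel})
    \<subseteq> Pow {S :: real mat. dim_row S = n}"
  by auto

lemma space_sketch_space: "space (sketch_space n) = {S. dim_row S = n}"
  unfolding sketch_space_def by (rule space_measure_of[OF sketch_generators])

lemma carrier_mat_in_sketch_space: "carrier_mat n q \<in> sets (sketch_space n)"
  unfolding sketch_space_def sets_measure_of[OF sketch_generators]
  by (rule sigma_sets.Basic) blast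

lemma entry_in_sketch_space:
  assumes "i < n" "j < q" "B \<in> sets borel"
  shows "{S \<in> carrier_mat n q. S $$ (i, j) \<in> B} \<in> sets (sketch_space n)"
  unfolding sketch_space_def sets_measure_of[OF sketch_generators]
  by (rule sigma_sets.Basic) (use assms in blast)

lemma space_restrict_sketch_space:
  "space (restrict_space (sketch_space n) (carrier_mat n q)) = carrier_mat n q"
  by (auto simp: space_restrict_space space_sketch_space)

text \<open>For a fixed width the preimages of Borel sets under the entries are themselves
  generators of the sigma-algebra.\<close>

lemma measurable_mat_sketch:
  "measurable_mat n q (restrict_space (sketch_space n) (carrier_mat n q)) (\<lambda>S. S)"
proof (rule measurable_matI)
  fix i j assume ij: "i < n" "j < q"
  show "(\<lambda>S. S $$ (i, j)) \<in> borel_measurable (restrict_space (sketch_space n) (carrier_mat n q))"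
  proof (rule measurableI)
    fix B :: "real set" assume B: "B \<in> sets borel"
    have "(\<lambda>S. S $$ (i, j)) -` B \<inter> space (restrict_space (sketch_space n) (carrier_mat n q))
        = {S \<in> carrier_mat n q. S $$ (i, j) \<in> B}"
      by (auto simp: space_restrict_sketch_space)
    also have "\<dots> \<in> sets (restrict_space (sketch_space n) (carrier_mat n q))"
      using entry_in_sketch_space[OF ij B] carrier_mat_in_sketch_space[of n q]
      by (subst sets_restrict_space_iff) auto
    finally show "(\<lambda>S. S $$ (i, j)) -` B \<inter> space (restrict_space (sketch_space n) (carrier_mat n q))
        \<in> sets (restrict_space (sketch_space n) (carrier_mat n q))" .
  qed simp
qed (simp add: space_restrict_sketch_space)

text \<open>The sets of matrices of one width are measurable and form a countable cover, so a
  measurability proof may fix \<open>q\<close>. This is what lets \<open>sketch_Z\<close> be treated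
  although the size of the inverted matrix is random.\<close>

lemma sketch_space_measurable_piecewise:
  assumes "\<And>q. f \<in> measurable (restrict_space (sketch_space n) (carrier_mat n q)) N"
  shows "f \<in> measurable (sketch_space n) N"
proof (rule measurable_piecewise_restrict[of "range (carrier_mat n)"])
  show "\<Omega> \<inter> space (sketch_space n) \<in> sets (sketch_space n)" if "\<Omega> \<in> range (carrier_mat n)" for \<Omega>
    using that carrier_mat_in_sketch_space sets.Int_space_eq2 by (metis imageE)
qed (use assms in \<open>auto simp: space_sketch_space\<close>)

lemma measurable_dim_col: "(\<lambda>S. real (dim_col S)) \<in> borel_measurable (sketch_space n)"
proof (rule sketch_space_measurable_piecewise)
  fix q
  have "(\<lambda>S. real (dim_col S)) \<in> borel_measurable (restrict_space (sketch_space n) (carrier_mat n q))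
    \<longleftrightarrow> (\<lambda>S. real q) \<in> borel_measurable (restrict_space (sketch_space n) (carrier_mat n q))"
    by (rule measurable_cong) (simp add: space_restrict_sketch_space)
  then show "(\<lambda>S. real (dim_col S)) \<in> borel_measurable (restrict_space (sketch_space n) (carrier_mat n q))"
    by simp
qed

lemma measurable_mat_sketch_Z:
  assumes A: "A \<in> carrier_mat n n" and W: "W \<in> carrier_mat n n"
  shows "measurable_mat n n (sketch_space n) (sketch_Z A W)"
proof (rule measurable_matI)
  show "sketch_Z A W S \<in> carrier_mat n n" if "S \<in> space (sketch_space n)" for S
    using A unfolding sketch_Z_def by (intro carrier_matI) auto
  fix i j assume ij: "i < n" "j < n"
  show "(\<lambda>S. sketch_Z A W S $$ (i, j)) \<in> borel_measurable (sketch_space n)"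
  proof (rule sketch_space_measurable_piecewise)
    fix q
    let ?M = "restrict_space (sketch_space n) (carrier_mat n q)"
    note S = measurable_mat_sketch[of n q]
    note St = measurable_mat_transpose[OF S]
    have a: "measurable_mat n n ?M (\<lambda>_. transpose_mat A)" "measurable_mat n n ?M (\<lambda>_. A)"
      "measurable_mat n n ?M (\<lambda>_. W)"
      using A W by (auto intro!: measurable_mat_const)
    note G = measurable_mat_inv[OF measurable_mat_mult[OF measurable_mat_mult[OF measurable_mat_mult[OF
            measurable_mat_mult[OF St a(2)] a(3)] a(1)] S]]
    have "measurable_mat n n ?M (\<lambda>S. sketch_Z A W S)"
      unfolding sketch_Z_def
      by (intro measurable_mat_mult[OF measurable_mat_mult[OF measurable_mat_mult[OF
              measurable_mat_mult[OF a(1) S] G] St] a(2)])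
    then show "(\<lambda>S. sketch_Z A W S $$ (i, j)) \<in> borel_measurable ?M"
      using measurable_matD(2) ij by blast
  qed
qed

section \<open>One step of the algorithms\<close>

lemma square_distrib:
  fixes X Y Z :: "real mat"
  assumes "X \<in> carrier_mat n n" "Y \<in> carrier_mat n n" "Z \<in> carrier_mat n n"
  shows "X * (Y - Z) = X * Y - X * Z" "(X - Y) * Z = X * Z - Y * Z"
  using assms by (auto intro: mult_minus_distrib_mat minus_mult_distrib_mat)

lemma sketch_Z_carrier:
  "A \<in> carrier_mat n n \<Longrightarrow> sketch_Z A W T \<in> carrier_mat n n"
  unfolding sketch_Z_def by (intro carrier_matI) auto

text \<open>With W = R R and R symmetric, the matrix inverted in Z is the Gram matrix of V =
  \<open>R * (transpose_mat A * T)\<close>, and the outer factors R complete V on the left and its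
  transpose on the right.\<close>

lemma sketch_Z_column_projection:
  assumes A: "A \<in> carrier_mat n n" and R: "R \<in> carrier_mat n n" "transpose_mat R = R"
    and T: "T \<in> carrier_mat n q"
  shows "R * sketch_Z A (R * R) T * R = column_projection (R * (transpose_mat A * T))"
proof -
  define B where "B = transpose_mat A * T"
  define Bt where "Bt = transpose_mat T * A"
  have B: "B \<in> carrier_mat n q" and Bt: "Bt \<in> carrier_mat q n"
    using A T by (auto simp: B_def Bt_def)
  have RB: "R * B \<in> carrier_mat n q" and BtR: "Bt * R \<in> carrier_mat q n" using B Bt R by auto
  have RR: "R * R \<in> carrier_mat n n" using R by simp
  have "transpose_mat B = Bt"
    unfolding B_def Bt_def using transpose_mult[of "transpose_mat A" n n T q] A T by simp
  then have Vt: "transpose_mat (R * B) = Bt * R"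
    using transpose_mult[OF R(1) B] R(2) by simp
  have "transpose_mat T * A * (R * R) * transpose_mat A * T = Bt * (R * R) * B"
    unfolding B_def Bt_def[symmetric]
    by (rule assoc_mult_mat[of _ q n _ n _ q]) (use A T Bt RR in auto)
  also have "Bt * (R * R) * B = Bt * (R * R * B)" by (rule assoc_mult_mat[OF Bt RR B])
  also have "R * R * B = R * (R * B)" by (rule assoc_mult_mat[OF R(1) R(1) B])
  also have "Bt * (R * (R * B)) = Bt * R * (R * B)"
    by (rule assoc_mult_mat[OF Bt R(1) RB, symmetric])
  finally have gram: "transpose_mat T * A * (R * R) * transpose_mat A * T
      = transpose_mat (R * B) * (R * B)" by (simp add: Vt)
  define H where "H = mat_inv (transpose_mat (R * B) * (R * B))"
  have H: "H \<in> carrier_mat q q" unfolding H_def by (rule mat_inv_gram(1)[OF RB])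
  have BH: "B * H \<in> carrier_mat n q" using B H by simp
  have Z: "sketch_Z A (R * R) T = B * H * Bt"
    unfolding sketch_Z_def gram H_def[symmetric] B_def[symmetric] Bt_def
    by (rule assoc_mult_mat[OF BH _ A]) (use T in simp)
  have "R * (B * H * Bt) * R = R * (B * H) * Bt * R"
    using assoc_mult_mat[OF R(1) BH Bt] by simp
  also have "R * (B * H) = R * B * H" by (rule assoc_mult_mat[OF R(1) B H, symmetric])
  also have "R * B * H * Bt * R = R * B * H * (Bt * R)"
    by (rule assoc_mult_mat[OF _ Bt R(1), of _ n]) (use RB H in auto)
  finally show ?thesis unfolding Z column_projection_def B_def[symmetric] H_def[symmetric]
    by (simp add: Vt)
qed

text \<open>Since A C = I, the residual I - A X is -A (X - C), so the update subtracts W Z (X - C)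
  from the error.\<close>

lemma alg1_step:
  assumes A: "A \<in> carrier_mat n n" and W: "W \<in> carrier_mat n n" and C: "C \<in> carrier_mat n n" "A * C = 1\<^sub>m n"
    and T: "T \<in> carrier_mat n q" and X: "X \<in> carrier_mat n n"
  shows "X + W * transpose_mat A * T * mat_inv (transpose_mat T * A * W * transpose_mat A * T)
       * transpose_mat T * (1\<^sub>m n - A * X) - C
     = (1\<^sub>m n - W * sketch_Z A W T) * (X - C)"
proof -
  define H where "H = mat_inv (transpose_mat T * A * W * transpose_mat A * T)"
  have "transpose_mat T * A * W * transpose_mat A * T \<in> carrier_mat q q" using T by (intro carrier_matI) auto
  then have H: "H \<in> carrier_mat q q" unfolding H_def by (rule mat_inv_carrier)
  define L where "L = transpose_mat A * T * H * transpose_mat T"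
  have At: "transpose_mat A \<in> carrier_mat n n" using A by simp
  have AT: "transpose_mat A * T \<in> carrier_mat n q" using At T by simp
  have ATH: "transpose_mat A * T * H \<in> carrier_mat n q" using AT H by simp
  have L: "L \<in> carrier_mat n n" using ATH T by (simp add: L_def)
  have "W * transpose_mat A * T * H * transpose_mat T = W * L"
    unfolding L_def using T
    by (simp only: assoc_mult_mat[OF W At T] assoc_mult_mat[OF W AT H]
        assoc_mult_mat[OF W ATH, of "transpose_mat T" n] transpose_carrier_mat)
  moreover have Z: "sketch_Z A W T = L * A" by (simp add: sketch_Z_def L_def H_def)
  moreover have "A * (X - C) = A * X - 1\<^sub>m n" using square_distrib(1)[OF A X C(1)] C(2) by simp
  moreover have "X + W * L * (1\<^sub>m n - A * X) - C = X - C - W * L * (A * X - 1\<^sub>m n)"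
  proof -
    have AX: "A * X \<in> carrier_mat n n" and WL: "W * L \<in> carrier_mat n n" using A X W L by auto
    have WLX: "W * L * (A * X) \<in> carrier_mat n n" using WL AX by simp
    have reorder: "X + (P - Q) - C = X - C - (Q - P)"
      if "P \<in> carrier_mat n n" "Q \<in> carrier_mat n n" for P Q
      by (rule eq_matI) (use X C(1) that in auto)
    show ?thesis
      unfolding square_distrib(1)[OF WL one_carrier_mat AX] square_distrib(1)[OF WL AX one_carrier_mat]
        right_mult_one_mat[OF WL]
      by (rule reorder[OF WL WLX])
  qed
  moreover have "(1\<^sub>m n - W * (L * A)) * (X - C) = X - C - W * L * (A * (X - C))"
  proof -
    have E: "X - C \<in> carrier_mat n n" using C by auto
    have "W * (L * A) * (X - C) = W * L * (A * (X - C))"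
      using W L A E by (simp add: square_mult_simps[where n = n])
    then show ?thesis
      using square_distrib(2)[of "1\<^sub>m n" n "W * (L * A)" "X - C"] W L A E
      by (simp add: left_mult_one_mat[OF E])
  qed
  ultimately show ?thesis by (simp add: H_def)
qed

text \<open>With E = X - C one has M = E A, hence M \<Theta> = E Z W. Its transpose is W Z E because
  E is symmetric, and the last term of the update is W Z E Z W. These are the terms of the expanded
  two-sided product. The second claim returns the symmetry of the error, so that the step can be
  iterated.\<close>

lemma alg3_step:
  assumes A: "A \<in> carrier_mat n n" "transpose_mat A = A"
    and W: "W \<in> carrier_mat n n" "transpose_mat W = W"
    and C: "C \<in> carrier_mat n n" "A * C = 1\<^sub>m n" "C * A = 1\<^sub>m n"
    and T: "T \<in> carrier_mat n q" and X: "X \<in> carrier_mat n n"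
    and E: "transpose_mat (X - C) = X - C"
    and \<Theta>: "\<Theta> = T * mat_inv (transpose_mat T * A * W * A * T) * transpose_mat T * A * W"
    and M: "M = X * A - 1\<^sub>m n"
  shows "X - M * \<Theta> - transpose_mat (M * \<Theta>) + transpose_mat \<Theta> * (A * X * A - A) * \<Theta> - C
     = (1\<^sub>m n - W * sketch_Z A W T) * (X - C) * (1\<^sub>m n - sketch_Z A W T * W)" (is ?step)
    and "transpose_mat ((1\<^sub>m n - W * sketch_Z A W T) * (X - C) * (1\<^sub>m n - sketch_Z A W T * W))
     = (1\<^sub>m n - W * sketch_Z A W T) * (X - C) * (1\<^sub>m n - sketch_Z A W T * W)" (is ?sym)
proof -
  define K where "K = transpose_mat T * A * W * A * T"
  have Kc: "K \<in> carrier_mat q q" using T unfolding K_def by (intro carrier_matI) auto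
  note sq = square_mult_simps[where n = n]
  have "K = transpose_mat T * (A * W * A) * T"
  proof -
    have Tt: "transpose_mat T \<in> carrier_mat q n" using T by simp
    show ?thesis unfolding K_def using A W
      by (simp only: assoc_mult_mat[OF Tt A(1) W(1)] assoc_mult_mat[OF Tt mult_carrier_mat[OF A(1) W(1)] A(1)])
  qed
  moreover have "transpose_mat (transpose_mat T * (A * W * A) * T) = transpose_mat T * (A * W * A) * T"
  proof -
    have AWA: "A * W * A \<in> carrier_mat n n" "transpose_mat (A * W * A) = A * W * A"
      using A W by (auto simp: transpose_mult[of _ n n _ n] sq)
    have Tt: "transpose_mat T \<in> carrier_mat q n" using T by simp
    have "transpose_mat (transpose_mat T * (A * W * A) * T)
        = transpose_mat T * (transpose_mat (A * W * A) * T)"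
      using transpose_mult[OF mult_carrier_mat[OF Tt AWA(1)] T] transpose_mult[OF Tt AWA(1)] by simp
    then show ?thesis using assoc_mult_mat[OF Tt AWA(1) T] AWA(2) by simp
  qed
  ultimately have Ks: "transpose_mat K = K" by simp
  define H where "H = mat_inv K"
  have H: "H \<in> carrier_mat q q" "transpose_mat H = H"
    using mat_inv_carrier[OF Kc] mat_inv_sym[OF Kc Ks] by (simp_all add: H_def)
  define L where "L = T * H * transpose_mat T"
  have TH: "T * H \<in> carrier_mat n q" using T H by simp
  have L: "L \<in> carrier_mat n n" using TH T by (simp add: L_def)
  have "transpose_mat L = L"
  proof -
    have "transpose_mat L = T * transpose_mat (T * H)"
      unfolding L_def using transpose_mult[OF TH, of "transpose_mat T" n] T by simp
    also have "transpose_mat (T * H) = H * transpose_mat T"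
      using transpose_mult[OF T H(1)] H(2) by simp
    also have "T * (H * transpose_mat T) = L"
      unfolding L_def by (rule assoc_mult_mat[symmetric, OF T H(1)]) (use T in simp)
    finally show ?thesis .
  qed
  note Ls = this
  have Z: "sketch_Z A W T = A * L * A"
    unfolding sketch_Z_def A(2) K_def[symmetric] H_def[symmetric] L_def
    using assoc_mult_mat[OF A(1) T H(1)] assoc_mult_mat[OF A(1) TH, of "transpose_mat T" n] T by simp
  define E where "E = X - C"
  have Ec: "E \<in> carrier_mat n n" using C by (auto simp: E_def)
  have Es: "transpose_mat E = E" using E by (simp add: E_def)
  define ZZ where "ZZ = A * L * A"
  have ZZ: "ZZ \<in> carrier_mat n n" "transpose_mat ZZ = ZZ"
    using A L Ls by (auto simp: ZZ_def transpose_mult[of _ n n _ n] sq)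
  have Th: "\<Theta> = L * A * W" by (simp add: \<Theta> L_def H_def K_def)
  have Tht: "transpose_mat \<Theta> = W * A * L"
    unfolding Th using A W L Ls by (simp add: transpose_mult[of _ n n _ n] sq)
  have ME: "M = E * A" unfolding M E_def using square_distrib(2)[OF X C(1) A(1)] C(3) by simp
  have AXA: "A * X * A - A = A * E * A"
  proof -
    have "A * E = A * X - 1\<^sub>m n" unfolding E_def using square_distrib(1)[OF A(1) X C(1)] C(2) by simp
    then show ?thesis
      using square_distrib(2)[of "A * X" n "1\<^sub>m n" A] A X by simp
  qed
  have 1: "M * \<Theta> = E * (ZZ * W)"
    unfolding ME Th ZZ_def using Ec A L W by (simp add: sq)
  have 2: "transpose_mat (E * (ZZ * W)) = W * ZZ * E"
    using Ec Es ZZ W by (simp add: transpose_mult[of _ n n _ n] sq)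
  have 3: "transpose_mat \<Theta> * (A * X * A - A) * \<Theta> = W * ZZ * E * (ZZ * W)"
    unfolding AXA Tht unfolding Th ZZ_def using Ec A L W by (simp add: sq)
  define F where "F = W * ZZ"
  define G where "G = ZZ * W"
  have FG: "F \<in> carrier_mat n n" "G \<in> carrier_mat n n" "transpose_mat F = G" "transpose_mat G = F"
    using W ZZ by (auto simp: F_def G_def transpose_mult[of _ n n _ n])
  have prods: "F * E \<in> carrier_mat n n" "E * G \<in> carrier_mat n n" "F * E * G \<in> carrier_mat n n"
    using FG Ec by auto
  have FE: "(1\<^sub>m n - F) * E = E - F * E"
    using square_distrib(2)[OF one_carrier_mat FG(1) Ec] left_mult_one_mat[OF Ec] by simp
  have FEc: "E - F * E \<in> carrier_mat n n" by (rule minus_carrier_mat[OF prods(1)])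
  have FEG: "(1\<^sub>m n - F) * E * (1\<^sub>m n - G) = E - F * E - (E * G - F * E * G)"
    unfolding FE square_distrib(1)[OF FEc one_carrier_mat FG(2)] right_mult_one_mat[OF FEc]
      square_distrib(2)[OF Ec prods(1) FG(2)] ..
  have "X - P - Q + R - C = E - Q - (P - R)"
    if "P \<in> carrier_mat n n" "Q \<in> carrier_mat n n" "R \<in> carrier_mat n n" for P Q R
    unfolding E_def by (rule eq_matI) (use X C(1) that in auto)
  from this[OF prods(2,1,3)] show ?step
    unfolding Z ZZ_def[symmetric] E_def[symmetric] 3 1 2
    unfolding F_def[symmetric] G_def[symmetric] FEG .
  have c: "1\<^sub>m n - F \<in> carrier_mat n n" "1\<^sub>m n - G \<in> carrier_mat n n"
    by (rule minus_carrier_mat[OF FG(1)], rule minus_carrier_mat[OF FG(2)])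
  have "transpose_mat ((1\<^sub>m n - F) * E * (1\<^sub>m n - G)) = (1\<^sub>m n - F) * (E * (1\<^sub>m n - G))"
  proof -
    have t: "transpose_mat (1\<^sub>m n - F) = 1\<^sub>m n - G" "transpose_mat (1\<^sub>m n - G) = 1\<^sub>m n - F"
      unfolding transpose_minus[OF one_carrier_mat FG(1)] transpose_minus[OF one_carrier_mat FG(2)]
        FG(3,4) by simp_all
    show ?thesis
      unfolding transpose_mult[OF mult_carrier_mat[OF c(1) Ec] c(2)] transpose_mult[OF c(1) Ec] t Es ..
  qed
  also have "\<dots> = (1\<^sub>m n - F) * E * (1\<^sub>m n - G)"
    by (rule assoc_mult_mat[OF c(1) Ec c(2), symmetric])
  finally show ?sym unfolding Z ZZ_def[symmetric] E_def[symmetric] F_def[symmetric] G_def[symmetric] .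
qed

text \<open>The rank is the size of a maximal independent set of columns, and independent vectors in
  a space of dimension \<open>dim_row T\<close> number at most that many.\<close>

lemma full_column_rank_dim_col_le:
  assumes "full_column_rank T"
  shows "dim_col T \<le> dim_row T"
proof -
  interpret vec_space "TYPE(real)" "dim_row T" .
  have T: "T \<in> carrier_mat (dim_row T) (dim_col T)" by simp
  have "rank T \<le> dim_row T"
  proof -
    have "{} \<subseteq> set (cols T) \<and> lin_indpt {}" unfolding lin_dep_def by auto
    then have "\<exists>B. finite B \<and> maximal B (\<lambda>U. U \<subseteq> set (cols T) \<and> lin_indpt U) \<and> {} \<subseteq> B"
      by (intro maximal_exists_superset[of "set (cols T)"]) (rule finite_set, rule conjunct1, assumption+)
    then obtain B where B: "maximal B (\<lambda>U. U \<subseteq> set (cols T) \<and> lin_indpt U)"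
      by (elim exE conjE)
    then have "B \<subseteq> carrier_vec (dim_row T)" "lin_indpt B"
      unfolding maximal_def using cols_dim[of T] by (blast, blast)
    then have "card B \<le> dim_row T" using li_le_dim(2)[OF fin_dim] dim_is_n by simp
    then show ?thesis using rank_card_indpt[OF T B] by simp
  qed
  then show ?thesis using assms by (simp add: full_column_rank_def)
qed

section \<open>Expectations of bounded random matrices\<close>

text \<open>Boundedness is carried along instead of integrability because it is preserved by
  products of dependent factors; over a probability space it gives integrability of every
  entry.\<close>

definition bounded_mat :: "nat \<Rightarrow> 'w measure \<Rightarrow> ('w \<Rightarrow> real mat) \<Rightarrow> bool" where
  "bounded_mat n M Y \<longleftrightarrow> measurable_mat n n M Y \<and>
     (\<exists>c. \<forall>\<omega> \<in> space M. \<forall>i < n. \<forall>j < n. \<bar>Y \<omega> $$ (i, j)\<bar> \<le> c)"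

lemma bounded_matI:
  assumes "measurable_mat n n M Y"
    and "\<And>\<omega> i j. \<omega> \<in> space M \<Longrightarrow> i < n \<Longrightarrow> j < n \<Longrightarrow> \<bar>Y \<omega> $$ (i, j)\<bar> \<le> c"
  shows "bounded_mat n M Y"
  unfolding bounded_mat_def using assms by (intro conjI exI[of _ c]) auto

lemma bounded_matD:
  assumes "bounded_mat n M Y"
  shows "measurable_mat n n M Y"
    and "\<And>\<omega>. \<omega> \<in> space M \<Longrightarrow> Y \<omega> \<in> carrier_mat n n"
    and "\<And>i j. i < n \<Longrightarrow> j < n \<Longrightarrow> (\<lambda>\<omega>. Y \<omega> $$ (i, j)) \<in> borel_measurable M"
proof -
  show Y: "measurable_mat n n M Y" using assms unfolding bounded_mat_def by (rule conjunct1)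
  show "Y \<omega> \<in> carrier_mat n n" if "\<omega> \<in> space M" for \<omega> by (rule measurable_matD(1)[OF Y that])
  show "(\<lambda>\<omega>. Y \<omega> $$ (i, j)) \<in> borel_measurable M" if "i < n" "j < n" for i j
    by (rule measurable_matD(2)[OF Y that])
qed

lemma bounded_mat_bound:
  assumes "bounded_mat n M Y"
  shows "\<exists>c \<ge> 0. \<forall>\<omega> \<in> space M. \<forall>i < n. \<forall>j < n. \<bar>Y \<omega> $$ (i, j)\<bar> \<le> c"
proof -
  obtain c where "\<forall>\<omega> \<in> space M. \<forall>i < n. \<forall>j < n. \<bar>Y \<omega> $$ (i, j)\<bar> \<le> c"
    using assms unfolding bounded_mat_def by blast
  then show ?thesis by (intro exI[of _ "max c 0"]) (simp add: max.coboundedI1)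
qed

lemma bounded_mat_const:
  assumes B: "B \<in> carrier_mat n n"
  shows "bounded_mat n M (\<lambda>_. B)"
proof (rule bounded_matI[OF measurable_mat_const[OF B]])
  fix i j assume "i < n" "j < n"
  then show "\<bar>B $$ (i, j)\<bar> \<le> (\<Sum>p\<in>{..<n} \<times> {..<n}. \<bar>B $$ p\<bar>)"
    by (intro member_le_sum[of "(i, j)" _ "\<lambda>p. \<bar>B $$ p\<bar>"]) auto
qed

lemma bounded_mat_mult:
  assumes X: "bounded_mat n M X" and Y: "bounded_mat n M Y"
  shows "bounded_mat n M (\<lambda>\<omega>. X \<omega> * Y \<omega>)"
proof -
  obtain c where c: "\<forall>\<omega> \<in> space M. \<forall>i < n. \<forall>j < n. \<bar>X \<omega> $$ (i, j)\<bar> \<le> c" "0 \<le> c"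
    using bounded_mat_bound[OF X] by blast
  obtain d where d: "\<forall>\<omega> \<in> space M. \<forall>i < n. \<forall>j < n. \<bar>Y \<omega> $$ (i, j)\<bar> \<le> d" "0 \<le> d"
    using bounded_mat_bound[OF Y] by blast
  show ?thesis
  proof (rule bounded_matI[OF measurable_mat_mult[OF bounded_matD(1)[OF X] bounded_matD(1)[OF Y]]])
    fix \<omega> i j assume \<omega>: "\<omega> \<in> space M" and ij: "i < n" "j < n"
    have "(X \<omega> * Y \<omega>) $$ (i, j) = (\<Sum>k<n. X \<omega> $$ (i, k) * Y \<omega> $$ (k, j))"
      using bounded_matD(2)[OF X \<omega>] bounded_matD(2)[OF Y \<omega>] ij
      by (simp add: scalar_prod_def lessThan_atLeast0)
    also have "\<bar>\<dots>\<bar> \<le> (\<Sum>k<n. \<bar>X \<omega> $$ (i, k) * Y \<omega> $$ (k, j)\<bar>)" by (rule sum_abs)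
    also have "\<dots> \<le> (\<Sum>k<n. c * d)"
    proof (rule sum_mono)
      fix k assume "k \<in> {..<n}"
      then have k: "k < n" by simp
      show "\<bar>X \<omega> $$ (i, k) * Y \<omega> $$ (k, j)\<bar> \<le> c * d"
        unfolding abs_mult using c(1)[rule_format, OF \<omega> ij(1) k] d(1)[rule_format, OF \<omega> k ij(2)] c(2)
        by (intro mult_mono) auto
    qed
    finally show "\<bar>(X \<omega> * Y \<omega>) $$ (i, j)\<bar> \<le> (\<Sum>k<n. c * d)" .
  qed
qed

lemma bounded_mat_diff:
  assumes X: "bounded_mat n M X" and Y: "bounded_mat n M Y"
  shows "bounded_mat n M (\<lambda>\<omega>. X \<omega> - Y \<omega>)"
proof -
  obtain c where c: "\<forall>\<omega> \<in> space M. \<forall>i < n. \<forall>j < n. \<bar>X \<omega> $$ (i, j)\<bar> \<le> c" "0 \<le> c"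
    using bounded_mat_bound[OF X] by blast
  obtain d where d: "\<forall>\<omega> \<in> space M. \<forall>i < n. \<forall>j < n. \<bar>Y \<omega> $$ (i, j)\<bar> \<le> d" "0 \<le> d"
    using bounded_mat_bound[OF Y] by blast
  show ?thesis
  proof (rule bounded_matI[OF measurable_mat_diff[OF bounded_matD(1)[OF X] bounded_matD(1)[OF Y]]])
    fix \<omega> i j assume \<omega>: "\<omega> \<in> space M" and ij: "i < n" "j < n"
    show "\<bar>(X \<omega> - Y \<omega>) $$ (i, j)\<bar> \<le> c + d"
      using bounded_matD(2)[OF X \<omega>] bounded_matD(2)[OF Y \<omega>] ij c(1)[rule_format, OF \<omega> ij] d(1)[rule_format, OF \<omega> ij] by simp
  qed
qed

lemma bounded_mat_comp:
  assumes Y: "bounded_mat n N Y" and f: "f \<in> measurable M N"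
  shows "bounded_mat n M (\<lambda>\<omega>. Y (f \<omega>))"
proof -
  obtain c where c: "\<forall>\<omega> \<in> space N. \<forall>i < n. \<forall>j < n. \<bar>Y \<omega> $$ (i, j)\<bar> \<le> c" "0 \<le> c"
    using bounded_mat_bound[OF Y] by blast
  show ?thesis
    by (rule bounded_matI[OF measurable_mat_comp[OF bounded_matD(1)[OF Y] f]])
      (rule c(1)[rule_format, OF measurable_space[OF f]])
qed

lemma bounded_mat_sets_cong:
  assumes "bounded_mat n M Y" "sets M = sets N"
  shows "bounded_mat n N Y"
  using bounded_mat_comp[OF assms(1), of "\<lambda>x. x" N] measurable_ident_sets[OF assms(2)[symmetric]] by simp

lemma bounded_mat_integrable:
  assumes M: "prob_space M" and Y: "bounded_mat n M Y" and ij: "i < n" "j < n"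
  shows "integrable M (\<lambda>\<omega>. Y \<omega> $$ (i, j))"
proof -
  interpret prob_space M by fact
  obtain c where c: "\<forall>\<omega> \<in> space M. \<forall>i < n. \<forall>j < n. \<bar>Y \<omega> $$ (i, j)\<bar> \<le> c" "0 \<le> c"
    using bounded_mat_bound[OF Y] by blast
  show ?thesis
    using c(1)[rule_format, OF _ ij] bounded_matD(3)[OF Y ij]
    by (intro integrable_const_bound[of _ c] AE_I2) auto
qed

lemma expected_mat_carrier: "expected_mat n M Y \<in> carrier_mat n n"
  by (simp add: expected_mat_def)

lemma expected_mat_index:
  "i < n \<Longrightarrow> j < n \<Longrightarrow> expected_mat n M Y $$ (i, j) = (\<integral>\<omega>. Y \<omega> $$ (i, j) \<partial>M)"
  by (simp add: expected_mat_def)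

lemma expected_mat_cong:
  assumes "\<And>\<omega>. \<omega> \<in> space M \<Longrightarrow> X \<omega> = Y \<omega>"
  shows "expected_mat n M X = expected_mat n M Y"
  unfolding expected_mat_def using assms
  by (intro cong_mat) (auto intro!: Bochner_Integration.integral_cong)

lemma expected_mat_const:
  assumes "prob_space M" "B \<in> carrier_mat n n"
  shows "expected_mat n M (\<lambda>_. B) = B"
  using assms by (intro eq_matI) (auto simp: expected_mat_def prob_space.prob_space)

lemma expected_mat_diff:
  assumes M: "prob_space M" and X: "bounded_mat n M X" and Y: "bounded_mat n M Y"
  shows "expected_mat n M (\<lambda>\<omega>. X \<omega> - Y \<omega>) = expected_mat n M X - expected_mat n M Y"
proof (rule eq_matI)
  fix i j assume "i < dim_row (expected_mat n M X - expected_mat n M Y)"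
    "j < dim_col (expected_mat n M X - expected_mat n M Y)"
  then have ij: "i < n" "j < n" by (auto simp: expected_mat_def)
  have "(\<integral>\<omega>. (X \<omega> - Y \<omega>) $$ (i, j) \<partial>M) = (\<integral>\<omega>. X \<omega> $$ (i, j) - Y \<omega> $$ (i, j) \<partial>M)"
  proof (rule Bochner_Integration.integral_cong)
    show "(X \<omega> - Y \<omega>) $$ (i, j) = X \<omega> $$ (i, j) - Y \<omega> $$ (i, j)" if "\<omega> \<in> space M" for \<omega>
      using ij bounded_matD(2)[OF Y that] by simp
  qed simp
  also have "\<dots> = (\<integral>\<omega>. X \<omega> $$ (i, j) \<partial>M) - (\<integral>\<omega>. Y \<omega> $$ (i, j) \<partial>M)"
    using bounded_mat_integrable[OF M X ij] bounded_mat_integrable[OF M Y ij]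
    by (rule Bochner_Integration.integral_diff)
  finally show "expected_mat n M (\<lambda>\<omega>. X \<omega> - Y \<omega>) $$ (i, j)
      = (expected_mat n M X - expected_mat n M Y) $$ (i, j)"
    using ij by (simp add: expected_mat_def)
qed (auto simp: expected_mat_def)

lemma triple_product_entry:
  fixes X Y Z :: "real mat"
  assumes "X \<in> carrier_mat n n" "Y \<in> carrier_mat n n" "Z \<in> carrier_mat n n" "i < n" "j < n"
  shows "(X * Y * Z) $$ (i, j) = (\<Sum>b<n. \<Sum>a<n. X $$ (i, a) * Y $$ (a, b) * Z $$ (b, j))"
  using assms by (simp add: scalar_prod_def lessThan_atLeast0 sum_distrib_right del: assoc_mult_mat)

lemma integral_double_sum:
  fixes f :: "nat \<Rightarrow> nat \<Rightarrow> 'w \<Rightarrow> real"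
  assumes f: "\<And>a b. a < n \<Longrightarrow> b < n \<Longrightarrow> integrable M (f a b)"
  shows "integrable M (\<lambda>\<omega>. \<Sum>b<n. \<Sum>a<n. f a b \<omega>)"
    and "(\<integral>\<omega>. (\<Sum>b<n. \<Sum>a<n. f a b \<omega>) \<partial>M) = (\<Sum>b<n. \<Sum>a<n. \<integral>\<omega>. f a b \<omega> \<partial>M)"
proof -
  have inner: "integrable M (\<lambda>\<omega>. \<Sum>a<n. f a b \<omega>)" if "b < n" for b
    using f that by (intro Bochner_Integration.integrable_sum) auto
  show "integrable M (\<lambda>\<omega>. \<Sum>b<n. \<Sum>a<n. f a b \<omega>)"
    by (rule Bochner_Integration.integrable_sum, rule inner) simp
  have "(\<integral>\<omega>. (\<Sum>b<n. \<Sum>a<n. f a b \<omega>) \<partial>M) = (\<Sum>b<n. \<integral>\<omega>. (\<Sum>a<n. f a b \<omega>) \<partial>M)"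
    using inner by (intro Bochner_Integration.integral_sum) auto
  also have "\<dots> = (\<Sum>b<n. \<Sum>a<n. \<integral>\<omega>. f a b \<omega> \<partial>M)"
    using f by (intro sum.cong refl Bochner_Integration.integral_sum) auto
  finally show "(\<integral>\<omega>. (\<Sum>b<n. \<Sum>a<n. f a b \<omega>) \<partial>M) = (\<Sum>b<n. \<Sum>a<n. \<integral>\<omega>. f a b \<omega> \<partial>M)" .
qed

text \<open>Linearity of the integral, applied to the double sum that expresses an entry of the
  triple product.\<close>

lemma expected_mat_sandwich_const:
  assumes M: "prob_space M" and Y: "bounded_mat n M Y"
    and B: "B \<in> carrier_mat n n" and C: "C \<in> carrier_mat n n"
  shows "expected_mat n M (\<lambda>\<omega>. B * Y \<omega> * C) = B * expected_mat n M Y * C"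
proof (rule eq_matI)
  fix i j assume "i < dim_row (B * expected_mat n M Y * C)" "j < dim_col (B * expected_mat n M Y * C)"
  then have ij: "i < n" "j < n"
    by (simp_all only: index_mult_mat carrier_matD[OF B] carrier_matD[OF C])
  have "(\<integral>\<omega>. (B * Y \<omega> * C) $$ (i, j) \<partial>M)
      = (\<integral>\<omega>. (\<Sum>b<n. \<Sum>a<n. B $$ (i, a) * Y \<omega> $$ (a, b) * C $$ (b, j)) \<partial>M)"
    using triple_product_entry[OF B bounded_matD(2)[OF Y] C ij]
    by (intro Bochner_Integration.integral_cong) auto
  also have "\<dots> = (\<Sum>b<n. \<Sum>a<n. B $$ (i, a) * (\<integral>\<omega>. Y \<omega> $$ (a, b) \<partial>M) * C $$ (b, j))"
    by (subst integral_double_sum) (use bounded_mat_integrable[OF M Y] in simp_all)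
  also have "\<dots> = (B * expected_mat n M Y * C) $$ (i, j)"
    unfolding triple_product_entry[OF B expected_mat_carrier C ij] by (simp add: expected_mat_index)
  finally show "expected_mat n M (\<lambda>\<omega>. B * Y \<omega> * C) $$ (i, j) = (B * expected_mat n M Y * C) $$ (i, j)"
    using ij by (simp add: expected_mat_index)
qed (simp_all only: index_mult_mat carrier_matD[OF B] carrier_matD[OF C] carrier_matD[OF expected_mat_carrier])

text \<open>Independence is assumed for real-valued functions only, because \<open>indep_var\<close> relates random
  variables of one type, whereas \<open>T\<close> is a single sketch and \<open>U\<close> the family of earlier ones.\<close>

lemma expected_mat_sandwich_indep:
  assumes M: "prob_space M" and T: "T \<in> measurable M N2" and U: "U \<in> measurable M N1"
    and indep: "\<And>f g. f \<in> borel_measurable N2 \<Longrightarrow> g \<in> borel_measurable N1 \<Longrightarrow>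
      prob_space.indep_var M borel (\<lambda>\<omega>. f (T \<omega>) :: real) borel (\<lambda>\<omega>. g (U \<omega>))"
    and F: "bounded_mat n N2 F" and G: "bounded_mat n N2 G" and Y: "bounded_mat n N1 Y"
  shows "expected_mat n M (\<lambda>\<omega>. F (T \<omega>) * Y (U \<omega>) * G (T \<omega>))
    = expected_mat n (distr M N2 T) (\<lambda>t. F t * expected_mat n M (\<lambda>\<omega>. Y (U \<omega>)) * G t)"
proof (rule eq_matI)
  interpret prob_space M by fact
  note FT = bounded_mat_comp[OF F T] and GT = bounded_mat_comp[OF G T] and YU = bounded_mat_comp[OF Y U]
  let ?E = "expected_mat n M (\<lambda>\<omega>. Y (U \<omega>))"
  fix i j assume "i < dim_row (expected_mat n (distr M N2 T) (\<lambda>t. F t * ?E * G t))"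
    "j < dim_col (expected_mat n (distr M N2 T) (\<lambda>t. F t * ?E * G t))"
  then have ij: "i < n" "j < n" by (auto simp: expected_mat_def)
  have FGm: "(\<lambda>t. F t $$ (i, a) * G t $$ (b, j)) \<in> borel_measurable N2" if "a < n" "b < n" for a b
    using bounded_matD(3)[OF F ij(1) that(1)] bounded_matD(3)[OF G that(2) ij(2)]
    by (rule borel_measurable_times)
  have FGi: "integrable M (\<lambda>\<omega>. F (T \<omega>) $$ (i, a) * G (T \<omega>) $$ (b, j))" if ab: "a < n" "b < n" for a b
  proof -
    obtain c where c: "\<forall>\<omega> \<in> space M. \<forall>i < n. \<forall>j < n. \<bar>F (T \<omega>) $$ (i, j)\<bar> \<le> c" "0 \<le> c"
      using bounded_mat_bound[OF FT] by blast
    obtain d where d: "\<forall>\<omega> \<in> space M. \<forall>i < n. \<forall>j < n. \<bar>G (T \<omega>) $$ (i, j)\<bar> \<le> d" "0 \<le> d"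
      using bounded_mat_bound[OF GT] by blast
    have "AE \<omega> in M. norm (F (T \<omega>) $$ (i, a) * G (T \<omega>) $$ (b, j)) \<le> c * d"
    proof (rule AE_I2)
      fix \<omega> assume \<omega>: "\<omega> \<in> space M"
      show "norm (F (T \<omega>) $$ (i, a) * G (T \<omega>) $$ (b, j)) \<le> c * d"
        unfolding real_norm_def abs_mult
        using c(1)[rule_format, OF \<omega> ij(1) ab(1)] d(1)[rule_format, OF \<omega> ab(2) ij(2)] c(2)
        by (intro mult_mono) auto
    qed
    moreover have "(\<lambda>\<omega>. F (T \<omega>) $$ (i, a) * G (T \<omega>) $$ (b, j)) \<in> borel_measurable M"
      by (rule measurable_compose[OF T FGm[OF ab]])
    ultimately show ?thesis by (rule integrable_const_bound)
  qed
  \<comment> \<open>The entries of \<open>F\<close> and \<open>G\<close> depend on the same sketch,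
    so they are grouped into one factor. Only the product of this factor with an entry of
    \<open>Y\<close> is split by independence.\<close>
  have ind: "indep_var borel (\<lambda>\<omega>. F (T \<omega>) $$ (i, a) * G (T \<omega>) $$ (b, j)) borel (\<lambda>\<omega>. Y (U \<omega>) $$ (a, b))"
    if ab: "a < n" "b < n" for a b
    by (rule indep[OF FGm[OF ab] bounded_matD(3)[OF Y ab]])
  have "(\<integral>\<omega>. (F (T \<omega>) * Y (U \<omega>) * G (T \<omega>)) $$ (i, j) \<partial>M)
      = (\<integral>\<omega>. (\<Sum>b<n. \<Sum>a<n. (F (T \<omega>) $$ (i, a) * G (T \<omega>) $$ (b, j)) * Y (U \<omega>) $$ (a, b)) \<partial>M)"
    using triple_product_entry[OF bounded_matD(2)[OF FT] bounded_matD(2)[OF YU] bounded_matD(2)[OF GT] ij]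
    by (intro Bochner_Integration.integral_cong) (auto simp: ac_simps)
  also have "\<dots> = (\<Sum>b<n. \<Sum>a<n.
      (\<integral>\<omega>. F (T \<omega>) $$ (i, a) * G (T \<omega>) $$ (b, j) * Y (U \<omega>) $$ (a, b) \<partial>M))"
    using indep_var_integrable[OF ind FGi bounded_mat_integrable[OF M YU]]
    by (intro integral_double_sum) auto
  also have "\<dots> = (\<Sum>b<n. \<Sum>a<n.
      (\<integral>\<omega>. F (T \<omega>) $$ (i, a) * G (T \<omega>) $$ (b, j) \<partial>M) * ?E $$ (a, b))"
    using indep_var_lebesgue_integral[OF ind FGi bounded_mat_integrable[OF M YU]]
    by (simp add: expected_mat_index)
  also have "\<dots> = (\<integral>\<omega>. (\<Sum>b<n. \<Sum>a<n. F (T \<omega>) $$ (i, a) * G (T \<omega>) $$ (b, j) * ?E $$ (a, b)) \<partial>M)"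
    by (subst integral_double_sum) (use FGi in simp_all)
  also have "\<dots> = (\<integral>t. (\<Sum>b<n. \<Sum>a<n. F t $$ (i, a) * G t $$ (b, j) * ?E $$ (a, b)) \<partial>distr M N2 T)"
    by (intro integral_distr[OF T, symmetric] borel_measurable_sum borel_measurable_times[OF FGm]) auto
  also have "\<dots> = (\<integral>t. (F t * ?E * G t) $$ (i, j) \<partial>distr M N2 T)"
  proof (rule Bochner_Integration.integral_cong)
    fix t assume "t \<in> space (distr M N2 T)"
    then have t: "t \<in> space N2" by simp
    show "(\<Sum>b<n. \<Sum>a<n. F t $$ (i, a) * G t $$ (b, j) * ?E $$ (a, b)) = (F t * ?E * G t) $$ (i, j)"
      unfolding triple_product_entry[OF bounded_matD(2)[OF F t] expected_mat_carrier
          bounded_matD(2)[OF G t] ij] by (simp add: ac_simps)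
  qed simp
  finally show "expected_mat n M (\<lambda>\<omega>. F (T \<omega>) * Y (U \<omega>) * G (T \<omega>)) $$ (i, j)
      = expected_mat n (distr M N2 T) (\<lambda>t. F t * ?E * G t) $$ (i, j)"
    using ij by (simp add: expected_mat_index)
qed (auto simp: expected_mat_def)

text \<open>The common form of both error recursions: Algorithm 1 takes \<open>G\<close> constantly
  equal to the identity, Algorithm 3 multiplies on both sides.\<close>

primrec sandwich_iterate ::
  "('s \<Rightarrow> real mat) \<Rightarrow> ('s \<Rightarrow> real mat) \<Rightarrow> real mat \<Rightarrow> (nat \<Rightarrow> 's) \<Rightarrow> nat \<Rightarrow> real mat" where
  "sandwich_iterate F G Y0 x 0 = Y0"
| "sandwich_iterate F G Y0 x (Suc k) = F (x k) * sandwich_iterate F G Y0 x k * G (x k)"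

text \<open>The iterate \<open>k\<close> reads only the samples 0, ..., k - 1. It is therefore a
  function of a finite family of sketches that does not contain the sample drawn in step
  \<open>k\<close>.\<close>

lemma sandwich_iterate_restrict:
  "k \<le> m \<Longrightarrow> sandwich_iterate F G Y0 (restrict x {..<m}) k = sandwich_iterate F G Y0 x k"
  by (induction k) auto

text \<open>The product space grows with \<open>k\<close>, so the induction hypothesis is
  transported along the restriction map from \<open>k + 1\<close> coordinates to
  \<open>k\<close>.\<close>

lemma bounded_mat_sandwich_iterate:
  assumes F: "bounded_mat n N F" and G: "bounded_mat n N G" and Y0: "Y0 \<in> carrier_mat n n"
  shows "bounded_mat n (PiM {..<k} (\<lambda>_. N)) (\<lambda>x. sandwich_iterate F G Y0 x k)"
proof (induction k)
  case 0
  then show ?case using Y0 by (simp add: bounded_mat_const)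
next
  case (Suc k)
  let ?M = "PiM {..<Suc k} (\<lambda>_. N)"
  have x: "(\<lambda>x. x k) \<in> measurable ?M N" by (rule measurable_component_singleton) simp
  have r: "(\<lambda>x. restrict x {..<k}) \<in> measurable ?M (PiM {..<k} (\<lambda>_. N))"
    by (rule measurable_restrict_subset) auto
  have "bounded_mat n ?M (\<lambda>x. sandwich_iterate F G Y0 x k)"
    using bounded_mat_comp[OF Suc.IH r] unfolding sandwich_iterate_restrict[OF order_refl] .
  then have "bounded_mat n ?M (\<lambda>x. F (x k) * sandwich_iterate F G Y0 x k * G (x k))"
    by (intro bounded_mat_mult bounded_mat_comp[OF F x] bounded_mat_comp[OF G x])
  then show ?case by simp
qed

text \<open>The new sketch is averaged against the expected old iterate, which is a constant matrix.
  This is legitimate because the index sets {k} and {0, ..., k - 1} are disjoint.\<close>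

lemma expected_sandwich_iterate:
  assumes P: "prob_space P" and indep: "prob_space.indep_vars P (\<lambda>_. N) S UNIV"
    and distr: "distr P N (S k) = D"
    and F: "bounded_mat n N F" and G: "bounded_mat n N G" and Y0: "Y0 \<in> carrier_mat n n"
  shows "expected_mat n P (\<lambda>\<omega>. sandwich_iterate F G Y0 (\<lambda>i. S i \<omega>) (Suc k))
    = expected_mat n D (\<lambda>t. F t * expected_mat n P (\<lambda>\<omega>. sandwich_iterate F G Y0 (\<lambda>i. S i \<omega>) k) * G t)"
proof -
  interpret prob_space P by fact
  let ?N = "PiM {..<k} (\<lambda>_. N)"
  let ?U = "\<lambda>\<omega>. restrict (\<lambda>i. S i \<omega>) {..<k}"
  have S: "S i \<in> measurable P N" for i using indep by (simp add: indep_vars_def)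
  have U: "?U \<in> measurable P ?N" using S by (intro measurable_restrict)
  have pair: "indep_var (PiM {k} (\<lambda>_. N)) (\<lambda>\<omega>. restrict (\<lambda>i. S i \<omega>) {k}) ?N ?U"
    by (rule indep_var_restrict[OF indep]) auto
  have ind: "indep_var borel (\<lambda>\<omega>. f (S k \<omega>) :: real) borel (\<lambda>\<omega>. g (?U \<omega>))"
    if f: "f \<in> borel_measurable N" and g: "g \<in> borel_measurable ?N" for f g
  proof -
    \<comment> \<open>Independence of index blocks speaks about product spaces, so a function of the
      single sketch is viewed as one on the product over the index set {k}.\<close>
    have fk: "(\<lambda>x. f (x k)) \<in> borel_measurable (PiM {k} (\<lambda>_. N))"
      by (rule measurable_compose[OF measurable_component_singleton[of k "{k}" "\<lambda>_. N"] f]) simp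
    from indep_var_compose[OF pair fk g] show ?thesis by (simp add: comp_def)
  qed
  from expected_mat_sandwich_indep[OF P S U ind F G bounded_mat_sandwich_iterate[OF F G Y0]]
  show ?thesis unfolding sandwich_iterate_restrict[OF order_refl] sandwich_iterate.simps distr .
qed

lemma expected_bilinear:
  assumes M: "prob_space M" and Y: "bounded_mat n M Y"
    and u: "u \<in> carrier_vec n" and v: "v \<in> carrier_vec n"
  shows "integrable M (\<lambda>\<omega>. scalar_prod u (Y \<omega> *\<^sub>v v))"
    and "scalar_prod u (expected_mat n M Y *\<^sub>v v) = (\<integral>\<omega>. scalar_prod u (Y \<omega> *\<^sub>v v) \<partial>M)"
proof -
  have eq: "scalar_prod u (B *\<^sub>v v) = (\<Sum>i<n. \<Sum>j<n. u $ i * B $$ (i, j) * v $ j)"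
    if "B \<in> carrier_mat n n" for B
    using that u v by (simp add: scalar_prod_def lessThan_atLeast0 sum_distrib_left mult.assoc)
  have cong: "scalar_prod u (Y \<omega> *\<^sub>v v) = (\<Sum>i<n. \<Sum>j<n. u $ i * Y \<omega> $$ (i, j) * v $ j)"
    if "\<omega> \<in> space M" for \<omega>
    by (rule eq[OF bounded_matD(2)[OF Y that]])
  have "integrable M (\<lambda>\<omega>. \<Sum>i<n. \<Sum>j<n. u $ i * Y \<omega> $$ (i, j) * v $ j)"
    using bounded_mat_integrable[OF M Y] by (intro Bochner_Integration.integrable_sum) auto
  then show "integrable M (\<lambda>\<omega>. scalar_prod u (Y \<omega> *\<^sub>v v))"
    using cong by (subst Bochner_Integration.integrable_cong[OF refl]) auto
  have "(\<integral>\<omega>. scalar_prod u (Y \<omega> *\<^sub>v v) \<partial>M)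
      = (\<integral>\<omega>. (\<Sum>i<n. \<Sum>j<n. u $ i * Y \<omega> $$ (i, j) * v $ j) \<partial>M)"
    using cong by (intro Bochner_Integration.integral_cong) auto
  also have "\<dots> = (\<Sum>i<n. \<Sum>j<n. u $ i * (\<integral>\<omega>. Y \<omega> $$ (i, j) \<partial>M) * v $ j)"
    by (subst integral_double_sum) (use bounded_mat_integrable[OF M Y] in simp_all)
  also have "\<dots> = scalar_prod u (expected_mat n M Y *\<^sub>v v)"
    unfolding eq[OF expected_mat_carrier] by (simp add: expected_mat_index)
  finally show "scalar_prod u (expected_mat n M Y *\<^sub>v v) = (\<integral>\<omega>. scalar_prod u (Y \<omega> *\<^sub>v v) \<partial>M)" ..
qed

text \<open>Pointwise, symmetry moves the left factor Q onto \<open>u\<close>, and idempotence turns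
  |Q u|^2 into u . Q u. Integrating this bound leaves only the expectation of Q, where the
  hypothesis \<open>le\<close> supplies the factor \<open>r\<close>.\<close>

lemma expected_projection_sandwich_op_norm:
  assumes M: "prob_space M" and n: "0 < n" and Q: "bounded_mat n M Q"
    and proj: "\<And>\<omega>. \<omega> \<in> space M \<Longrightarrow> transpose_mat (Q \<omega>) = Q \<omega> \<and> Q \<omega> * Q \<omega> = Q \<omega>"
    and r: "0 \<le> r"
    and le: "\<And>u. u \<in> carrier_vec n \<Longrightarrow> scalar_prod u (expected_mat n M Q *\<^sub>v u) \<le> r * scalar_prod u u"
    and B: "B \<in> carrier_mat n n"
  shows "op_norm (expected_mat n M (\<lambda>\<omega>. Q \<omega> * B * Q \<omega>)) \<le> r * op_norm B"
proof (rule op_norm_le_bilinear[OF expected_mat_carrier n])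
  have b0: "0 \<le> op_norm B" by (rule op_norm_nonneg[OF B n])
  show "0 \<le> r * op_norm B" using r b0 by simp
  have QBQ: "bounded_mat n M (\<lambda>\<omega>. Q \<omega> * B * Q \<omega>)"
    by (intro bounded_mat_mult Q bounded_mat_const[OF B])
  fix u v :: "real Matrix.vec" assume u: "u \<in> carrier_vec n" and v: "v \<in> carrier_vec n"
  have pointwise: "scalar_prod u ((Q \<omega> * B * Q \<omega>) *\<^sub>v v)
      \<le> op_norm B / 2 * (scalar_prod u (Q \<omega> *\<^sub>v u) + scalar_prod v (Q \<omega> *\<^sub>v v))"
    if \<omega>: "\<omega> \<in> space M" for \<omega>
  proof -
    note Qc = bounded_matD(2)[OF Q \<omega>]
    have Qs: "transpose_mat (Q \<omega>) = Q \<omega>" and Qi: "Q \<omega> * Q \<omega> = Q \<omega>" using proj[OF \<omega>] by auto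
    have Qu: "Q \<omega> *\<^sub>v u \<in> carrier_vec n" and Qv: "Q \<omega> *\<^sub>v v \<in> carrier_vec n" using Qc u v by auto
    have BQv: "B *\<^sub>v (Q \<omega> *\<^sub>v v) \<in> carrier_vec n" using B Qv by simp
    have "(Q \<omega> * B * Q \<omega>) *\<^sub>v v = Q \<omega> *\<^sub>v (B *\<^sub>v (Q \<omega> *\<^sub>v v))"
      using assoc_mult_mat_vec[OF mult_carrier_mat[OF Qc B] Qc v] assoc_mult_mat_vec[OF Qc B Qv] by simp
    then have "scalar_prod u ((Q \<omega> * B * Q \<omega>) *\<^sub>v v) = scalar_prod (Q \<omega> *\<^sub>v u) (B *\<^sub>v (Q \<omega> *\<^sub>v v))"
      using symmetric_scalar_prod[OF Qc Qs u BQv] by simp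
    also have "\<dots> \<le> op_norm B / 2 * (scalar_prod (Q \<omega> *\<^sub>v u) (Q \<omega> *\<^sub>v u) + scalar_prod (Q \<omega> *\<^sub>v v) (Q \<omega> *\<^sub>v v))"
      by (rule bilinear_le_op_norm[OF B Qu Qv n])
    finally show ?thesis
      using projection_scalar_prod[OF Qc Qs Qi u] projection_scalar_prod[OF Qc Qs Qi v] by simp
  qed
  note iu = expected_bilinear[OF M Q u u] and iv = expected_bilinear[OF M Q v v]
  have "scalar_prod u (expected_mat n M (\<lambda>\<omega>. Q \<omega> * B * Q \<omega>) *\<^sub>v v)
      = (\<integral>\<omega>. scalar_prod u ((Q \<omega> * B * Q \<omega>) *\<^sub>v v) \<partial>M)"
    by (rule expected_bilinear(2)[OF M QBQ u v])
  also have "\<dots> \<le> (\<integral>\<omega>. op_norm B / 2 * (scalar_prod u (Q \<omega> *\<^sub>v u) + scalar_prod v (Q \<omega> *\<^sub>v v)) \<partial>M)"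
    using iu(1) iv(1) pointwise expected_bilinear(1)[OF M QBQ u v] by (intro integral_mono) auto
  also have "\<dots> = op_norm B / 2 * (scalar_prod u (expected_mat n M Q *\<^sub>v u)
      + scalar_prod v (expected_mat n M Q *\<^sub>v v))"
    unfolding iu(2) iv(2) using iu(1) iv(1) by simp
  also have "\<dots> \<le> op_norm B / 2 * (r * scalar_prod u u + r * scalar_prod v v)"
    using le[OF u] le[OF v] b0 by (intro mult_left_mono add_mono) auto
  finally show "scalar_prod u (expected_mat n M (\<lambda>\<omega>. Q \<omega> * B * Q \<omega>) *\<^sub>v v)
      \<le> r * op_norm B / 2 * (scalar_prod u u + scalar_prod v v)"
    by (simp add: algebra_simps)
qed

section \<open>Contraction of the expected error\<close>

lemma unit_vec_quadratic_form:
  fixes B :: "real mat"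
  assumes B: "B \<in> carrier_mat n n" and i: "i < n"
  shows "scalar_prod (unit_vec n i) (B *\<^sub>v unit_vec n i) = B $$ (i, i)"
proof -
  have "B *\<^sub>v unit_vec n i \<in> carrier_vec n" by (rule mult_mat_vec_carrier[OF B unit_vec_carrier])
  then have "scalar_prod (unit_vec n i) (B *\<^sub>v unit_vec n i) = (B *\<^sub>v unit_vec n i) $ i"
    using i by (rule scalar_prod_left_unit)
  also have "\<dots> = scalar_prod (row B i) (unit_vec n i)" using B i by simp
  also have "\<dots> = B $$ (i, i)" using B i by (simp add: scalar_prod_right_unit)
  finally show ?thesis .
qed

locale sketched_inversion =
  fixes n :: nat and A W :: "real mat" and D :: "real mat measure"
  assumes n: "0 < n"
    and A: "A \<in> carrier_mat n n" "invertible_mat A"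
    and W: "spd_mat n W"
    and D: "prob_space D" "sets D = sets (sketch_space n)"
begin

abbreviation R where "R \<equiv> mat_sqrt W"
abbreviation Ri where "Ri \<equiv> mat_inv R"
abbreviation Ai where "Ai \<equiv> mat_inv A"
abbreviation Z where "Z \<equiv> sketch_Z A W"
abbreviation EZ where "EZ \<equiv> expected_Z n A W D"

definition P where "P T = R * Z T * R"

lemma W_carrier: "W \<in> carrier_mat n n"
  using W by (simp add: spd_mat_def)

lemma W_sym: "transpose_mat W = W"
  using W by (simp add: spd_mat_def sym_mat_def)

lemma R_carrier: "R \<in> carrier_mat n n"
  using mat_sqrt_spd(1)[OF W] by (simp add: spd_mat_def)

lemma R_sym: "transpose_mat R = R"
  using mat_sqrt_spd(1)[OF W] by (simp add: spd_mat_def sym_mat_def)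

lemma R_square: "R * R = W"
  by (rule mat_sqrt_spd(2)[OF W])

lemma Ri_carrier: "Ri \<in> carrier_mat n n"
  by (rule mat_inv_carrier[OF R_carrier])

lemma R_Ri: "R * Ri = 1\<^sub>m n"
  and Ri_R: "Ri * R = 1\<^sub>m n"
  using mat_inv_regular[OF R_carrier spd_det_nonzero[OF mat_sqrt_spd(1)[OF W]]] .

lemma A_det: "det A \<noteq> 0"
proof -
  obtain B where B: "A * B = 1\<^sub>m (dim_row A)" "B * A = 1\<^sub>m (dim_row B)"
    using A(2) by (auto simp: invertible_mat_def inverts_mat_def)
  \<comment> \<open>\<open>invertible_mat\<close> leaves the shape of the inverse open. Both
    dimensions are read off by comparing column counts in the two identities.\<close>
  have "dim_col B = n" using arg_cong[OF B(1), of dim_col] A(1) by simp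
  moreover have "dim_row B = n" using arg_cong[OF B(2), of dim_col] A(1) by simp
  ultimately have "B \<in> carrier_mat n n" by (intro carrier_matI)
  from det_mult[OF A(1) this] have "det A * det B = 1" using B(1) A(1) by simp
  then show ?thesis by auto
qed

lemma Ai_carrier: "Ai \<in> carrier_mat n n"
  by (rule mat_inv_carrier[OF A(1)])

lemma A_Ai: "A * Ai = 1\<^sub>m n"
  and Ai_A: "Ai * A = 1\<^sub>m n"
  using mat_inv_regular[OF A(1) A_det] .

lemma Z_carrier: "Z T \<in> carrier_mat n n"
  by (rule sketch_Z_carrier[OF A(1)])

lemma P_carrier: "P T \<in> carrier_mat n n"
  unfolding P_def by (intro mult_carrier_mat[of _ n n] R_carrier Z_carrier)

lemma P_projection:
  assumes T: "dim_row T = n"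
  shows "transpose_mat (P T) = P T" "P T * P T = P T"
    "(\<Sum>i<n. P T $$ (i, i)) \<le> real (dim_col T)"
proof -
  have Tc: "T \<in> carrier_mat n (dim_col T)" using T by (intro carrier_matI) auto
  define V where "V = R * (transpose_mat A * T)"
  have V: "V \<in> carrier_mat n (dim_col T)"
    unfolding V_def by (intro mult_carrier_mat[of _ n n] R_carrier Tc) (simp add: A(1))
  have "P T = column_projection V"
    unfolding P_def V_def using sketch_Z_column_projection[OF A(1) R_carrier R_sym Tc]
    unfolding R_square .
  then show "transpose_mat (P T) = P T" "P T * P T = P T"
    "(\<Sum>i<n. P T $$ (i, i)) \<le> real (dim_col T)"
    using column_projection_sym[OF V] column_projection_idem[OF V] column_projection_trace_le[OF V]
    by simp_all
qed

lemma bounded_P: "bounded_mat n (sketch_space n) P"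
proof (rule bounded_matI)
  have c: "measurable_mat n n (sketch_space n) (\<lambda>_. R)" by (rule measurable_mat_const[OF R_carrier])
  show "measurable_mat n n (sketch_space n) P"
    unfolding P_def[abs_def]
    by (rule measurable_mat_mult[OF measurable_mat_mult[OF c measurable_mat_sketch_Z[OF A(1) W_carrier]] c])
  fix T i j assume "T \<in> space (sketch_space n)" and ij: "i < n" "j < n"
  then have "dim_row T = n" by (simp add: space_sketch_space)
  from P_projection(1,2)[OF this] show "\<bar>P T $$ (i, j)\<bar> \<le> 1"
    by (intro projection_entry_bound[OF P_carrier] ij)
qed

text \<open>Conjugating back passes the entry bound for projections on to Z.\<close>

lemma Z_eq: "Z T = Ri * P T * Ri"
proof -
  note sq = square_mult_simps[where n = n]
  have "Ri * P T * Ri = (Ri * R) * Z T * (R * Ri)"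
    unfolding P_def using R_carrier Ri_carrier Z_carrier[of T] by (simp add: sq)
  then show ?thesis unfolding R_Ri Ri_R using Z_carrier[of T] by (simp add: sq)
qed

lemma bounded_Z: "bounded_mat n (sketch_space n) Z"
  unfolding Z_eq[abs_def]
  by (intro bounded_mat_mult bounded_mat_const bounded_P Ri_carrier)

lemma bounded_left_factor: "bounded_mat n (sketch_space n) (\<lambda>T. 1\<^sub>m n - W * Z T)"
  and bounded_right_factor: "bounded_mat n (sketch_space n) (\<lambda>T. 1\<^sub>m n - Z T * W)"
  by (intro bounded_mat_diff bounded_mat_mult bounded_mat_const bounded_Z W_carrier one_carrier_mat)+

lemmas bounded_D = bounded_mat_sets_cong[OF _ D(2)[symmetric]]

lemma space_D: "space D = {T. dim_row T = n}"
  using sets_eq_imp_space_eq[OF D(2)] by (simp add: space_sketch_space)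

lemma EZ_carrier: "EZ \<in> carrier_mat n n"
  unfolding expected_Z_def by (rule expected_mat_carrier)

text \<open>The matrix whose smallest eigenvalue defines the rate is thereby an average of
  orthogonal projections, and all bounds on the rate rest on this.\<close>

lemma expected_P: "expected_mat n D P = R * EZ * R"
  unfolding P_def[abs_def] expected_Z_def
  by (rule expected_mat_sandwich_const[OF D(1) bounded_D[OF bounded_Z] R_carrier R_carrier])

lemma expected_P_carrier: "R * EZ * R \<in> carrier_mat n n"
  by (intro mult_carrier_mat[of _ n n] R_carrier EZ_carrier)

lemma expected_P_sym: "transpose_mat (R * EZ * R) = R * EZ * R"
  unfolding expected_P[symmetric]
proof (rule eq_matI)
  fix i j assume "i < dim_row (expected_mat n D P)" "j < dim_col (expected_mat n D P)"
  then have ij: "i < n" "j < n" by (auto simp: expected_mat_def)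
  have "P T $$ (j, i) = P T $$ (i, j)" if "T \<in> space D" for T
  proof -
    have T: "dim_row T = n" using that by (simp add: space_D)
    show ?thesis
      using index_transpose_mat(1)[of i "P T" j, unfolded P_projection(1)[OF T] carrier_matD[OF P_carrier]]
        ij by simp
  qed
  then have "(\<integral>T. P T $$ (j, i) \<partial>D) = (\<integral>T. P T $$ (i, j) \<partial>D)"
    by (intro Bochner_Integration.integral_cong) auto
  then show "transpose_mat (expected_mat n D P) $$ (i, j) = expected_mat n D P $$ (i, j)"
    using ij by (simp add: expected_mat_def)
qed (auto simp: expected_mat_def)

section \<open>Bounds on the convergence rate\<close>

lemma rate_eq: "rate n A W D = 1 - lambda_min (R * EZ * R)"
  by (simp add: rate_def)

text \<open>On an eigenvector v for the smallest eigenvalue, the quadratic form of the averaged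
  projection is the mean of |P v|^2, so that eigenvalue is nonnegative.\<close>

lemma rate_le_1: "rate n A W D \<le> 1"
proof -
  let ?l = "lambda_min (R * EZ * R)"
  obtain v where v: "v \<in> carrier_vec n" "v \<noteq> 0\<^sub>v n" "(R * EZ * R) *\<^sub>v v = ?l \<cdot>\<^sub>v v"
    using lambda_min_eigenvalue[OF expected_P_carrier expected_P_sym n]
    unfolding eigenvalue_def eigenvector_def carrier_matD(1)[OF expected_P_carrier] by blast
  have "0 \<le> (\<integral>T. scalar_prod v (P T *\<^sub>v v) \<partial>D)"
  proof (rule Bochner_Integration.integral_nonneg_AE, rule AE_I2)
    fix T assume "T \<in> space D"
    then have T: "dim_row T = n" by (simp add: space_D)
    show "0 \<le> scalar_prod v (P T *\<^sub>v v)"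
      using projection_scalar_prod[OF P_carrier P_projection(1,2)[OF T] v(1)]
        scalar_prod_self_nonneg[of "P T *\<^sub>v v"] by simp
  qed
  also have "\<dots> = scalar_prod v ((R * EZ * R) *\<^sub>v v)"
    using expected_bilinear(2)[OF D(1) bounded_D[OF bounded_P] v(1) v(1)] unfolding expected_P ..
  also have "\<dots> = ?l * scalar_prod v v" unfolding v(3) using v(1) by simp
  finally have "0 \<le> ?l * scalar_prod v v" .
  moreover have "0 < scalar_prod v v"
    using scalar_prod_self_nonneg[of v] scalar_prod_self_eq_0[OF v(1)] v(2) by linarith
  ultimately show ?thesis by (simp add: rate_eq zero_le_mult_iff)
qed

text \<open>Full column rank gives q \<le> n almost surely, hence both the integrability of q and
  the first inequality. For the second, n times the smallest eigenvalue is at most the trace of the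
  averaged projection, whose expectation is taken inside the trace.\<close>

lemma rate_lower_bounds:
  assumes rank: "AE T in D. full_column_rank T"
  shows "0 \<le> 1 - (\<integral>T. real (dim_col T) \<partial>D) / real n"
    and "1 - (\<integral>T. real (dim_col T) \<partial>D) / real n \<le> rate n A W D"
proof -
  interpret prob_space D by (rule D(1))
  have le: "AE T in D. real (dim_col T) \<le> real n"
    using rank AE_space
  proof eventually_elim
    case (elim T)
    then show ?case using full_column_rank_dim_col_le[of T] by (simp add: space_D)
  qed
  have "(\<lambda>T. real (dim_col T)) \<in> borel_measurable D"
    using measurable_dim_col[of n] measurable_cong_sets[OF D(2) refl] by blast
  moreover have "AE T in D. norm (real (dim_col T)) \<le> real n" using le by simp
  ultimately have int: "integrable D (\<lambda>T. real (dim_col T))" by (intro integrable_const_bound)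
  have "(\<integral>T. real (dim_col T) \<partial>D) \<le> real n" by (rule integral_le_const[OF int le])
  then show "0 \<le> 1 - (\<integral>T. real (dim_col T) \<partial>D) / real n" using n by simp
  let ?l = "lambda_min (R * EZ * R)"
  \<comment> \<open>A diagonal entry is the Rayleigh quotient at a unit vector. Summing over
    \<open>i\<close> compares the smallest eigenvalue with the trace without a
    diagonalization.\<close>
  have diag: "?l \<le> (R * EZ * R) $$ (i, i)" if i: "i < n" for i
  proof -
    have u: "unit_vec n i \<in> carrier_vec n" by simp
    have "?l * scalar_prod (unit_vec n i) (unit_vec n i)
        \<le> scalar_prod (unit_vec n i) ((R * EZ * R) *\<^sub>v unit_vec n i)"
      by (rule lambda_min_quadratic_form[OF expected_P_carrier expected_P_sym u])
    also have "scalar_prod (unit_vec n i) ((R * EZ * R) *\<^sub>v unit_vec n i) = (R * EZ * R) $$ (i, i)"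
      by (rule unit_vec_quadratic_form[OF expected_P_carrier i])
    finally show ?thesis using i by simp
  qed
  have "real n * ?l = (\<Sum>i<n. ?l)" by simp
  also have "\<dots> \<le> (\<Sum>i<n. (R * EZ * R) $$ (i, i))" using diag by (intro sum_mono) auto
  also have "\<dots> = (\<Sum>i<n. \<integral>T. P T $$ (i, i) \<partial>D)"
    unfolding expected_P[symmetric] by (intro sum.cong) (auto simp: expected_mat_index)
  also have "\<dots> = (\<integral>T. (\<Sum>i<n. P T $$ (i, i)) \<partial>D)"
    using bounded_mat_integrable[OF D(1) bounded_D[OF bounded_P]]
    by (intro Bochner_Integration.integral_sum[symmetric]) auto
  also have "\<dots> \<le> (\<integral>T. real (dim_col T) \<partial>D)"
  proof (rule integral_mono[OF _ int])
    show "integrable D (\<lambda>T. \<Sum>i<n. P T $$ (i, i))"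
      using bounded_mat_integrable[OF D(1) bounded_D[OF bounded_P]]
      by (intro Bochner_Integration.integrable_sum) auto
    show "(\<Sum>i<n. P T $$ (i, i)) \<le> real (dim_col T)" if "T \<in> space D" for T
      using P_projection(3)[of T] that by (simp add: space_D)
  qed
  finally have "?l \<le> (\<integral>T. real (dim_col T) \<partial>D) / real n"
    using n by (simp add: pos_le_divide_eq mult.commute)
  then show "1 - (\<integral>T. real (dim_col T) \<partial>D) / real n \<le> rate n A W D" by (simp add: rate_eq)
qed

section \<open>Contraction by the complementary projections\<close>

lemma bounded_complement: "bounded_mat n D (\<lambda>T. 1\<^sub>m n - P T)"
  by (intro bounded_D bounded_mat_diff bounded_mat_const bounded_P one_carrier_mat)

lemma expected_complement: "expected_mat n D (\<lambda>T. 1\<^sub>m n - P T) = 1\<^sub>m n - R * EZ * R"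
  using expected_mat_diff[OF D(1) bounded_mat_const[OF one_carrier_mat] bounded_D[OF bounded_P]]
  unfolding expected_mat_const[OF D(1) one_carrier_mat] expected_P .

text \<open>The factor is the Rayleigh bound for the averaged complement: u . (I - E[P]) u is at
  most (1 - l) |u|^2, with l the smallest eigenvalue of E[P].\<close>

lemma complement_contraction:
  assumes r: "0 \<le> rate n A W D" and B: "B \<in> carrier_mat n n"
  shows "op_norm (expected_mat n D (\<lambda>T. (1\<^sub>m n - P T) * B * (1\<^sub>m n - P T))) \<le> rate n A W D * op_norm B"
proof (rule expected_projection_sandwich_op_norm[OF D(1) n bounded_complement _ r _ B])
  show "transpose_mat (1\<^sub>m n - P T) = 1\<^sub>m n - P T \<and> (1\<^sub>m n - P T) * (1\<^sub>m n - P T) = 1\<^sub>m n - P T"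
    if "T \<in> space D" for T
  proof -
    have T: "dim_row T = n" using that by (simp add: space_D)
    show ?thesis using complement_projection[OF P_carrier P_projection(1,2)[OF T]] by blast
  qed
  fix u :: "real Matrix.vec" assume u: "u \<in> carrier_vec n"
  have EPu: "(R * EZ * R) *\<^sub>v u \<in> carrier_vec n"
    by (rule mult_mat_vec_carrier[OF expected_P_carrier u])
  have "(1\<^sub>m n - R * EZ * R) *\<^sub>v u = u - (R * EZ * R) *\<^sub>v u"
    using minus_mult_distrib_mat_vec[OF one_carrier_mat expected_P_carrier u] one_mult_mat_vec[OF u]
    by simp
  then have "scalar_prod u (expected_mat n D (\<lambda>T. 1\<^sub>m n - P T) *\<^sub>v u)
      = scalar_prod u u - scalar_prod u ((R * EZ * R) *\<^sub>v u)"
    unfolding expected_complement using scalar_prod_minus_distrib[OF u u EPu] by simp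
  also have "\<dots> \<le> rate n A W D * scalar_prod u u"
    using lambda_min_quadratic_form[OF expected_P_carrier expected_P_sym u]
    by (simp add: rate_eq algebra_simps)
  finally show "scalar_prod u (expected_mat n D (\<lambda>T. 1\<^sub>m n - P T) *\<^sub>v u) \<le> rate n A W D * scalar_prod u u" .
qed

text \<open>Take B = I in the two-sided contraction: a projection is its own square, so the
  two-sided average is the average of the projection itself.\<close>

lemma expected_complement_op_norm:
  assumes r: "0 \<le> rate n A W D"
  shows "op_norm (1\<^sub>m n - R * EZ * R) \<le> rate n A W D"
proof -
  have "expected_mat n D (\<lambda>T. (1\<^sub>m n - P T) * 1\<^sub>m n * (1\<^sub>m n - P T)) = expected_mat n D (\<lambda>T. 1\<^sub>m n - P T)"
  proof (rule expected_mat_cong)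
    fix T assume "T \<in> space D"
    then have T: "dim_row T = n" by (simp add: space_D)
    note Q = complement_projection[OF P_carrier P_projection(1,2)[OF T]]
    show "(1\<^sub>m n - P T) * 1\<^sub>m n * (1\<^sub>m n - P T) = 1\<^sub>m n - P T"
      unfolding right_mult_one_mat[OF Q(1)] by (rule Q(3))
  qed
  then have "op_norm (1\<^sub>m n - R * EZ * R) \<le> rate n A W D * op_norm (1\<^sub>m n)"
    using complement_contraction[OF r one_carrier_mat] unfolding expected_complement by simp
  also have "\<dots> \<le> rate n A W D * 1" by (rule mult_left_mono[OF op_norm_one_le[OF n] r])
  finally show ?thesis by simp
qed

text \<open>With W = R R, the factor \<open>Ri\<close> cancels one R on the left, and R
  \<open>Ri\<close> = I is inserted on the right. \<open>X\<close> is arbitrary because Algorithm 1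
  needs this for the averaged Z and Algorithm 3 for each single Z.\<close>

lemma conjugate_left_factor:
  assumes X: "X \<in> carrier_mat n n"
  shows "Ri * (1\<^sub>m n - W * X) = (1\<^sub>m n - R * X * R) * Ri"
proof -
  note sq = square_mult_simps[where n = n]
  note c = R_carrier Ri_carrier X
  have WX: "W * X \<in> carrier_mat n n" and RXR: "R * X * R \<in> carrier_mat n n"
    by (intro mult_carrier_mat[of _ n n] W_carrier c)+
  have "Ri * (W * X) = Ri * (R * R * X)" by (simp only: R_square)
  also have "\<dots> = (Ri * R) * (R * X)" using c by (simp add: sq)
  also have "\<dots> = R * X * (R * Ri)" unfolding Ri_R R_Ri using c by (simp add: sq)
  also have "\<dots> = R * X * R * Ri" using c by (simp add: sq)
  finally show ?thesis
    unfolding square_distrib(1)[OF Ri_carrier one_carrier_mat WX]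
      square_distrib(2)[OF one_carrier_mat RXR Ri_carrier]
      right_mult_one_mat[OF Ri_carrier] left_mult_one_mat[OF Ri_carrier] by simp
qed

lemma conjugate_right_factor:
  assumes X: "X \<in> carrier_mat n n"
  shows "(1\<^sub>m n - X * W) * Ri = Ri * (1\<^sub>m n - R * X * R)"
proof -
  note sq = square_mult_simps[where n = n]
  note c = R_carrier Ri_carrier X
  have XW: "X * W \<in> carrier_mat n n" and RXR: "R * X * R \<in> carrier_mat n n"
    by (intro mult_carrier_mat[of _ n n] W_carrier c)+
  have "X * W * Ri = X * (R * R) * Ri" by (simp only: R_square)
  also have "\<dots> = X * R * (R * Ri)" using c by (simp add: sq)
  also have "\<dots> = (Ri * R) * (X * R)" unfolding Ri_R R_Ri using c by (simp add: sq)
  also have "\<dots> = Ri * (R * X * R)" using c by (simp add: sq)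
  finally show ?thesis
    unfolding square_distrib(2)[OF one_carrier_mat XW Ri_carrier]
      square_distrib(1)[OF Ri_carrier one_carrier_mat RXR]
      right_mult_one_mat[OF Ri_carrier] left_mult_one_mat[OF Ri_carrier] by simp
qed

text \<open>Membership in the carrier is part of the induction because the one-step identity
  presupposes the dimensions of the current iterate.\<close>

lemma alg1_error:
  assumes X0: "X0 \<in> carrier_mat n n" and x: "\<And>i. dim_row (x i) = n"
  shows "alg1 A W X0 x k \<in> carrier_mat n n \<and> alg1 A W X0 x k - Ai
    = sandwich_iterate (\<lambda>T. 1\<^sub>m n - W * Z T) (\<lambda>_. 1\<^sub>m n) (X0 - Ai) x k"
proof (induction k)
  case 0
  then show ?case using X0 by simp
next
  case (Suc k)
  let ?X = "alg1 A W X0 x k"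
  have X: "?X \<in> carrier_mat n n" using Suc by blast
  have T: "x k \<in> carrier_mat n (dim_col (x k))" using x by (intro carrier_matI) auto
  have "alg1 A W X0 x (Suc k) - Ai = (1\<^sub>m n - W * Z (x k)) * (?X - Ai)"
    using alg1_step[OF A(1) W_carrier Ai_carrier A_Ai T X] unfolding alg1.simps carrier_matD(1)[OF A(1)] .
  moreover have "(1\<^sub>m n - W * Z (x k)) * (?X - Ai) * 1\<^sub>m n = (1\<^sub>m n - W * Z (x k)) * (?X - Ai)"
    by (intro right_mult_one_mat[of _ n n] mult_carrier_mat[of _ n n] minus_carrier_mat W_carrier Z_carrier Ai_carrier)
  moreover have "alg1 A W X0 x (Suc k) \<in> carrier_mat n n"
    using W_carrier X unfolding alg1.simps by (intro carrier_matI) auto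
  ultimately show ?case using Suc by (metis sandwich_iterate.simps(2))
qed

text \<open>Symmetry of the error is carried through the induction, as each step consumes it and
  restores it. It starts from the symmetry of \<open>X0\<close> and of the inverse of the symmetric
  matrix \<open>A\<close>.\<close>

lemma alg3_error:
  assumes A_sym: "sym_mat A" and X0: "X0 \<in> carrier_mat n n" "sym_mat X0"
    and x: "\<And>i. dim_row (x i) = n"
  shows "alg3 A W X0 x k \<in> carrier_mat n n \<and> transpose_mat (alg3 A W X0 x k - Ai) = alg3 A W X0 x k - Ai
    \<and> alg3 A W X0 x k - Ai
      = sandwich_iterate (\<lambda>T. 1\<^sub>m n - W * Z T) (\<lambda>T. 1\<^sub>m n - Z T * W) (X0 - Ai) x k"
proof (induction k)
  case 0
  have "transpose_mat (X0 - Ai) = X0 - Ai"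
    unfolding transpose_minus[OF X0(1) Ai_carrier] using X0(2) mat_inv_sym[OF A(1)] A_sym
    by (simp add: sym_mat_def)
  then show ?case using X0 by simp
next
  case (Suc k)
  let ?X = "alg3 A W X0 x k"
  have X: "?X \<in> carrier_mat n n" and E: "transpose_mat (?X - Ai) = ?X - Ai" using Suc by blast+
  have T: "x k \<in> carrier_mat n (dim_col (x k))" using x by (intro carrier_matI) auto
  have As: "transpose_mat A = A" using A_sym by (simp add: sym_mat_def)
  note step = alg3_step[OF A(1) As W_carrier W_sym Ai_carrier A_Ai Ai_A T X E refl refl]
  have eq: "alg3 A W X0 x (Suc k) - Ai = (1\<^sub>m n - W * Z (x k)) * (?X - Ai) * (1\<^sub>m n - Z (x k) * W)"
    using step(1) unfolding alg3.simps Let_def carrier_matD(1)[OF A(1)] .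
  have "alg3 A W X0 x (Suc k) \<in> carrier_mat n n"
    using W_carrier unfolding alg3.simps Let_def by (intro carrier_matI) auto
  with step(2) eq Suc show ?case by simp
qed

section \<open>Expected errors along a sequence of independent sketches\<close>

context
  fixes M :: "'w measure" and S :: "nat \<Rightarrow> 'w \<Rightarrow> real mat" and X0 :: "real mat"
  assumes M: "prob_space M"
    and indep: "prob_space.indep_vars M (\<lambda>_. sketch_space n) S UNIV"
    and distr: "\<And>k. distr M (sketch_space n) (S k) = D"
    and X0: "X0 \<in> carrier_mat n n"
begin

lemma sketch_dim_row:
  assumes "\<omega> \<in> space M"
  shows "dim_row (S i \<omega>) = n"
proof -
  have "S i \<in> measurable M (sketch_space n)"
    using indep unfolding prob_space.indep_vars_def[OF M] by blast
  from measurable_space[OF this assms] show ?thesis by (simp add: space_sketch_space)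
qed

lemma X0_error_carrier: "X0 - Ai \<in> carrier_mat n n"
  by (rule minus_carrier_mat[OF Ai_carrier])

abbreviation E1 where "E1 k \<equiv> expected_mat n M (\<lambda>\<omega>. alg1 A W X0 (\<lambda>i. S i \<omega>) k - Ai)"
abbreviation E3 where "E3 k \<equiv> expected_mat n M (\<lambda>\<omega>. alg3 A W X0 (\<lambda>i. S i \<omega>) k - Ai)"

text \<open>Only the left factor is random, so after the independence step the expected error is a
  constant right factor and leaves the average.\<close>

lemma alg1_expected_error:
  "E1 (Suc k) = (1\<^sub>m n - W * EZ) * E1 k"
proof -
  have eq: "E1 k = expected_mat n M (\<lambda>\<omega>. sandwich_iterate (\<lambda>T. 1\<^sub>m n - W * Z T) (\<lambda>_. 1\<^sub>m n) (X0 - Ai) (\<lambda>i. S i \<omega>) k)"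
    for k
    by (rule expected_mat_cong, rule conjunct2[OF alg1_error[OF X0 sketch_dim_row]])
  note E = expected_mat_carrier[of n M "\<lambda>\<omega>. alg1 A W X0 (\<lambda>i. S i \<omega>) k - Ai"]
  note F = bounded_D[OF bounded_left_factor]
  have "E1 (Suc k) = expected_mat n D (\<lambda>T. (1\<^sub>m n - W * Z T) * E1 k * 1\<^sub>m n)"
    unfolding eq
    by (rule expected_sandwich_iterate[OF M indep distr bounded_left_factor
          bounded_mat_const[OF one_carrier_mat] X0_error_carrier])
  \<comment> \<open>The identity factor moves to the left, which puts the random matrix in the
    middle between two constants, as \<open>expected_mat_sandwich_const\<close> requires.\<close>
  also have "\<dots> = expected_mat n D (\<lambda>T. 1\<^sub>m n * (1\<^sub>m n - W * Z T) * E1 k)"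
  proof (rule expected_mat_cong)
    fix T assume "T \<in> space D"
    note c = bounded_matD(2)[OF F this]
    show "(1\<^sub>m n - W * Z T) * E1 k * 1\<^sub>m n = 1\<^sub>m n * (1\<^sub>m n - W * Z T) * E1 k"
      unfolding right_mult_one_mat[OF mult_carrier_mat[OF c E]] left_mult_one_mat[OF c] ..
  qed
  also have "\<dots> = 1\<^sub>m n * expected_mat n D (\<lambda>T. 1\<^sub>m n - W * Z T) * E1 k"
    by (rule expected_mat_sandwich_const[OF D(1) F one_carrier_mat E])
  also have "\<dots> = expected_mat n D (\<lambda>T. 1\<^sub>m n - W * Z T) * E1 k"
    unfolding left_mult_one_mat[OF expected_mat_carrier] ..
  also have "expected_mat n D (\<lambda>T. 1\<^sub>m n - W * Z T) = 1\<^sub>m n - expected_mat n D (\<lambda>T. W * Z T)"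
    using expected_mat_diff[OF D(1) bounded_mat_const[OF one_carrier_mat]
        bounded_D[OF bounded_mat_mult[OF bounded_mat_const[OF W_carrier] bounded_Z]]]
    unfolding expected_mat_const[OF D(1) one_carrier_mat] .
  also have "expected_mat n D (\<lambda>T. W * Z T) = expected_mat n D (\<lambda>T. W * Z T * 1\<^sub>m n)"
    unfolding right_mult_one_mat[OF mult_carrier_mat[OF W_carrier Z_carrier]] ..
  also have "\<dots> = W * EZ * 1\<^sub>m n"
    unfolding expected_Z_def
    by (rule expected_mat_sandwich_const[OF D(1) bounded_D[OF bounded_Z] W_carrier one_carrier_mat])
  also have "\<dots> = W * EZ" by (rule right_mult_one_mat[OF mult_carrier_mat[OF W_carrier EZ_carrier]])
  finally show ?thesis .
qed

text \<open>After multiplication by \<open>Ri\<close> on both sides the recursion reads off as left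
  multiplication by I - E[P], and submultiplicativity gives one factor of the rate per step.\<close>

lemma alg1_expected_norm:
  assumes r: "0 \<le> rate n A W D"
  shows "weighted_norm W (E1 k) \<le> rate n A W D ^ k * weighted_norm W (X0 - Ai)"
proof (induction k)
  case 0
  then show ?case by (simp add: expected_mat_const[OF M X0_error_carrier])
next
  case (Suc k)
  note E = expected_mat_carrier[of n M "\<lambda>\<omega>. alg1 A W X0 (\<lambda>i. S i \<omega>) k - Ai"]
  have F: "1\<^sub>m n - W * EZ \<in> carrier_mat n n" and Q: "1\<^sub>m n - R * EZ * R \<in> carrier_mat n n"
    by (rule minus_carrier_mat[OF mult_carrier_mat[OF W_carrier EZ_carrier]],
        rule minus_carrier_mat[OF expected_P_carrier])
  have RE: "Ri * E1 k \<in> carrier_mat n n" by (rule mult_carrier_mat[OF Ri_carrier E])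
  have "Ri * E1 (Suc k) = Ri * (1\<^sub>m n - W * EZ) * E1 k"
    unfolding alg1_expected_error by (rule assoc_mult_mat[OF Ri_carrier F E, symmetric])
  also have "\<dots> = (1\<^sub>m n - R * EZ * R) * Ri * E1 k" unfolding conjugate_left_factor[OF EZ_carrier] ..
  also have "\<dots> = (1\<^sub>m n - R * EZ * R) * (Ri * E1 k)" by (rule assoc_mult_mat[OF Q Ri_carrier E])
  finally have "Ri * E1 (Suc k) * Ri = (1\<^sub>m n - R * EZ * R) * (Ri * E1 k * Ri)"
    using assoc_mult_mat[OF Q RE Ri_carrier] by simp
  then have "weighted_norm W (E1 (Suc k)) \<le> op_norm (1\<^sub>m n - R * EZ * R) * weighted_norm W (E1 k)"
    unfolding weighted_norm_def
    using op_norm_mult_le[OF Q mult_carrier_mat[OF RE Ri_carrier] n] by simp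
  also have "\<dots> \<le> rate n A W D * weighted_norm W (E1 k)"
    unfolding weighted_norm_def
    by (intro mult_right_mono expected_complement_op_norm[OF r]
        op_norm_nonneg[OF mult_carrier_mat[OF RE Ri_carrier] n])
  also have "\<dots> \<le> rate n A W D * (rate n A W D ^ k * weighted_norm W (X0 - Ai))"
    by (rule mult_left_mono[OF Suc.IH r])
  finally show ?case by (simp add: mult.assoc)
qed

text \<open>The random factor occurs on both sides, so the average does not factor. The step is
  bounded as a whole by the two-sided contraction, with B the conjugated expected error of the
  current step.\<close>

lemma alg3_expected_norm:
  assumes r: "0 \<le> rate n A W D" and A_sym: "sym_mat A" and X0_sym: "sym_mat X0"
  shows "weighted_norm W (E3 k) \<le> rate n A W D ^ k * weighted_norm W (X0 - Ai)"
proof (induction k)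
  case 0
  then show ?case by (simp add: expected_mat_const[OF M X0_error_carrier])
next
  case (Suc k)
  have eq: "E3 k = expected_mat n M (\<lambda>\<omega>. sandwich_iterate (\<lambda>T. 1\<^sub>m n - W * Z T)
      (\<lambda>T. 1\<^sub>m n - Z T * W) (X0 - Ai) (\<lambda>i. S i \<omega>) k)" for k
    by (rule expected_mat_cong,
        rule conjunct2[OF conjunct2[OF alg3_error[OF A_sym X0 X0_sym sketch_dim_row]]])
  note E = expected_mat_carrier[of n M "\<lambda>\<omega>. alg3 A W X0 (\<lambda>i. S i \<omega>) k - Ai"]
  define B where "B = Ri * E3 k * Ri"
  have B: "B \<in> carrier_mat n n"
    unfolding B_def by (intro mult_carrier_mat[of _ n n] Ri_carrier E)
  note F = bounded_D[OF bounded_left_factor] and G = bounded_D[OF bounded_right_factor]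
  have FEG: "bounded_mat n D (\<lambda>T. (1\<^sub>m n - W * Z T) * E3 k * (1\<^sub>m n - Z T * W))"
    by (intro bounded_mat_mult F G bounded_mat_const E)
  have "E3 (Suc k) = expected_mat n D (\<lambda>T. (1\<^sub>m n - W * Z T) * E3 k * (1\<^sub>m n - Z T * W))"
    unfolding eq
    by (rule expected_sandwich_iterate[OF M indep distr bounded_left_factor bounded_right_factor
          X0_error_carrier])
  then have "Ri * E3 (Suc k) * Ri
      = expected_mat n D (\<lambda>T. Ri * ((1\<^sub>m n - W * Z T) * E3 k * (1\<^sub>m n - Z T * W)) * Ri)"
    \<comment> \<open>The outer factors \<open>Ri\<close> are moved inside the average, so that the
      change to projections can be made for each sketch separately.\<close>
    using expected_mat_sandwich_const[OF D(1) FEG Ri_carrier Ri_carrier] by simp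
  also have "\<dots> = expected_mat n D (\<lambda>T. (1\<^sub>m n - P T) * B * (1\<^sub>m n - P T))"
  proof (rule expected_mat_cong)
    fix T assume T: "T \<in> space D"
    note Fc = bounded_matD(2)[OF F T] and Gc = bounded_matD(2)[OF G T]
    have Q: "1\<^sub>m n - P T \<in> carrier_mat n n" by (rule minus_carrier_mat[OF P_carrier])
    note sq = square_mult_simps[where n = n]
    define F' where "F' = 1\<^sub>m n - W * Z T"
    define G' where "G' = 1\<^sub>m n - Z T * W"
    define Q' where "Q' = 1\<^sub>m n - P T"
    define E' where "E' = E3 k"
    have c: "F' \<in> carrier_mat n n" "G' \<in> carrier_mat n n" "Q' \<in> carrier_mat n n" "E' \<in> carrier_mat n n"
      using Fc Gc Q E by (simp_all add: F'_def G'_def Q'_def E'_def)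
    have "Ri * (F' * E' * G') * Ri = (Ri * F') * E' * (G' * Ri)"
      using c Ri_carrier by (simp add: sq)
    also have "Ri * F' = Q' * Ri"
      unfolding F'_def Q'_def P_def by (rule conjugate_left_factor[OF Z_carrier])
    also have "G' * Ri = Ri * Q'"
      unfolding G'_def Q'_def P_def by (rule conjugate_right_factor[OF Z_carrier])
    also have "Q' * Ri * E' * (Ri * Q') = Q' * (Ri * E' * Ri) * Q'"
      using c Ri_carrier by (simp add: sq)
    finally show "Ri * ((1\<^sub>m n - W * Z T) * E3 k * (1\<^sub>m n - Z T * W)) * Ri
        = (1\<^sub>m n - P T) * B * (1\<^sub>m n - P T)"
      unfolding F'_def G'_def Q'_def E'_def B_def .
  qed
  finally have "weighted_norm W (E3 (Suc k)) \<le> rate n A W D * weighted_norm W (E3 k)"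
    unfolding weighted_norm_def using complement_contraction[OF r B] unfolding B_def by simp
  also have "\<dots> \<le> rate n A W D * (rate n A W D ^ k * weighted_norm W (X0 - Ai))"
    by (rule mult_left_mono[OF Suc.IH r])
  finally show ?case by (simp add: mult.assoc)
qed

end

end

theorem theorem6p1:
  fixes n :: nat and A W X0 :: "real mat"
    and D :: "real mat measure"
    and P :: "'w measure" and S :: "nat \<Rightarrow> 'w \<Rightarrow> real mat"
  assumes n: "0 < n"
    and A: "A \<in> carrier_mat n n" "invertible_mat A"
    and W: "spd_mat n W"
    and X0: "X0 \<in> carrier_mat n n"
    and D: "prob_space D" "sets D = sets (sketch_space n)"
    and rank: "AE T in D. full_column_rank T"
    and P: "prob_space P"
    and indep: "prob_space.indep_vars P (\<lambda>_. sketch_space n) S UNIV"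
    and distr: "\<And>k. distr P (sketch_space n) (S k) = D"
  shows
    "(\<forall>k. expected_mat n P (\<lambda>\<omega>. alg1 A W X0 (\<lambda>i. S i \<omega>) (Suc k) - mat_inv A)
        = (1\<^sub>m n - W * expected_Z n A W D)
          * expected_mat n P (\<lambda>\<omega>. alg1 A W X0 (\<lambda>i. S i \<omega>) k - mat_inv A))
   \<and> (\<forall>k. weighted_norm W (expected_mat n P (\<lambda>\<omega>. alg1 A W X0 (\<lambda>i. S i \<omega>) k - mat_inv A))
        \<le> rate n A W D ^ k * weighted_norm W (X0 - mat_inv A))
   \<and> (sym_mat A \<and> sym_mat X0 \<longrightarrow>
        (\<forall>k. weighted_norm W (expected_mat n P (\<lambda>\<omega>. alg3 A W X0 (\<lambda>i. S i \<omega>) k - mat_inv A))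
          \<le> rate n A W D ^ k * weighted_norm W (X0 - mat_inv A)))
   \<and> 0 \<le> 1 - (\<integral>T. real (dim_col T) \<partial>D) / real n
   \<and> 1 - (\<integral>T. real (dim_col T) \<partial>D) / real n \<le> rate n A W D
   \<and> rate n A W D \<le> 1"
proof -
  interpret si: sketched_inversion n A W D by (rule sketched_inversion.intro) fact+
  note bounds = si.rate_lower_bounds[OF rank]
  \<comment> \<open>Both norm bounds multiply inequalities by the rate, hence the nonnegativity;
    through the lower bounds it rests on the full rank hypothesis.\<close>
  have r: "0 \<le> rate n A W D" using bounds by linarith
  show ?thesis
    using si.alg1_expected_error[OF P indep distr X0] si.alg1_expected_norm[OF P indep distr X0 r]
      si.alg3_expected_norm[OF P indep distr X0 r] bounds si.rate_le_1
    by blast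
qed

end
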